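(* Let $\mathcal{X}$ be a complete and separable metric space and let $\mathcal{Y}\subseteq\mathbb{R}$ be closed. Let $\mathrm{P}_1,\mathrm{P}_2\in\mathcal{M}_1(\mathcal{X}\times\mathcal{Y})$ be probability measures. Let $\mathcal{X}_1,\dots,\mathcal{X}_B\subseteq\mathcal{X}$ be Borel sets (not necessarily disjoint) with $\mathcal{X}=\bigcup_{b=1}^B\mathcal{X}_b$ and $\mathrm{P}_i(\mathcal{X}_b\times\mathcal{Y})>0$ for all $b\in\{1,\dots,B\}$ and $i\in\{1,2\}$. For all $i\in\{1,2\}$ and $b\in\{1,\dots,B\}$, let $\lambda_{i,b}>0$ and let $k_{i,b}$ be a bounded and measurable kernel on $\mathcal{X}_b$ with separable RKHS $H_{i,b}$. Put $\kappa_b:=\max\{\|k_{1,b}\|_\infty,\|k_{2,b}\|_\infty\}$ and $\tau_b:=\min\{\lambda_{1,b},\lambda_{2,b}\}$ for all $b$. Let $L$ be a convex and Lipschitz continuous loss function with Lipschitz constant $|L|_1$. Let $w_1,\dots,w_B$ be measurable weight functions satisfying (W1) $w_b:\mathcal{X}\to[0,1]$ for all $b\in\{1,\dots,B\}$; (W2) $\sum_{b=1}^Bw_b(x)=1$ for all $x\in\mathcal{X}$; (W3) $w_b(x)=0$ for all $x\notin\mathcal{X}_b$ and all $b\in\{1,\dots,B\}$. For $i=1,2$ let the localized SVM $f_{\mathrm{P}_i,\boldsymbol{\lambda_i},\boldsymbol{k_i}}:\mathcal{X}\to\mathbb{R}$ be defined by $$f_{\mathrm{P}_i,\boldsymbol{\lambda_i},\boldsymbol{k_i}}(x):=\sum_{b=1}^Bw_b(x)\cdot\hat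 f_{\mathrm{P}_{i,b},\lambda_{i,b},k_{i,b}}(x),$$ where $\mathrm{P}_{i,b}$ is the local probability measure of $\mathrm{P}_i$ on $\mathcal{X}_b\times\mathcal{Y}$ and $\hat f$ denotes the zero-extension to $\mathcal{X}$ of the local SVM $f_{\mathrm{P}_{i,b},\lambda_{i,b},k_{i,b}}:\mathcal{X}_b\to\mathbb{R}$. Then, for all $p\in[1,\infty)$ and all $i\in\{1,2\}$, $$\begin{aligned}\|f_{\mathrm{P}_1,\boldsymbol{\lambda_1},\boldsymbol{k_1}}-f_{\mathrm{P}_2,\boldsymbol{\lambda_2},\boldsymbol{k_2}}\|_{L_p(\mathrm{P}_i^X)}\le|L|_1\cdot\sum_{b=1}^B\left(\mathrm{P}_i^X(\mathcal{X}_b)\right)^{1/p}\cdot\bigg(&\frac{\kappa_b^2}{\tau_b}\cdot\|\mathrm{P}_{1,b}-\mathrm{P}_{2,b}\|_{tv}+\frac{\kappa_b^2}{\tau_b^2}\cdot|\lambda_{1,b}-\lambda_{2,b}|\\&+\frac1{2\tau_b}\cdot\|k_{1,b}-k_{2,b}\|_{L_p(\mathrm{P}_{i,b}^X\otimes\mathrm{P}_{i,b}^X)}+\frac{\kappa_b}{\tau_b}\cdot\sqrt{\|k_{1,b}-k_{2,b}\|_{L_p(\mathrm{P}_{i,b}^X\otimes\mathrm{P}_{i,b}^X)}}\bigg).\end{aligned}$$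
   Context: All spaces carry their Borel $\sigma$-algebras; $\mathcal{M}_1(\mathcal{X}\times\mathcal{Y})$ is the set of Borel probability measures on $\mathcal{X}\times\mathcal{Y}$. For a probability measure $\mathrm{Q}$ on $\tilde{\mathcal{X}}\times\mathcal{Y}$, $\mathrm{Q}^X$ denotes its marginal distribution on $\tilde{\mathcal{X}}$. A kernel on a set $S$ is a symmetric positive semidefinite function $k:S\times S\to\mathbb{R}$; its reproducing kernel Hilbert space is abbreviated RKHS. For a kernel $k$, $\|k\|_\infty:=\sup_{x}\sqrt{k(x,x)}$, and $k$ is bounded if this is finite. A loss function is a measurable function $L:\mathcal{X}\times\mathcal{Y}\times\mathbb{R}\to[0,\infty)$. It is convex if $L(x,y,\cdot)$ is convex for all $(x,y)$, and Lipschitz continuous if there is $c\ge0$ with $|L(x,y,t_1)-L(x,y,t_2)|\le c|t_1-t_2|$ for all $x,y,t_1,t_2$; the smallest such $c$ is $|L|_1$. The shifted loss function is $L^\star(x,y,t):=L(x,y,t)-L(x,y,0)$. For a Borel set $\tilde{\mathcal{X}}\subseteq\mathcal{X}$, a Borel probability measure $\mathrm{Q}$ on $\tilde{\mathcal{X}}\times\mathcal{Y}$, $\lambda>0$ and a bounded measurable kernel $k$ on $\tilde{\mathcal{X}}$ with separable RKHS $H$, the support vector machine (SVM) is the (existing and unique) minimizer $$f_{\mathrm{Q},\lambda,k}:=\arg\inf_{f\in H}\ \mathbb{E}_{\mathrm{Q}}[L^\star(X,Y,f(X))]+\lambda\|f\|_H^2,\qquad f_{\mathrm{Q},\lambda,k}:\tilde{\mathcal{X}}\to\mathbb{R}$$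 (the loss $L$ is fixed and omitted from the notation). Local probability measures: if $\mathrm{P}(\tilde{\mathcal{X}}\times\mathcal{Y})>0$, then $\mathrm{P}_{\tilde{\mathcal{X}}}:=\frac{1}{\mathrm{P}(\tilde{\mathcal{X}}\times\mathcal{Y})}\mathrm{P}|_{\tilde{\mathcal{X}}\times\mathcal{Y}}$; write $\mathrm{P}_{i,b}:=(\mathrm{P}_i)_{\mathcal{X}_b}$. Zero-extension: for $g:\tilde{\mathcal{X}}\to\mathbb{R}$, $\hat g:\mathcal{X}\to\mathbb{R}$ equals $g$ on $\tilde{\mathcal{X}}$ and $0$ elsewhere. Vectors: $\boldsymbol{\lambda_i}=(\lambda_{i,1},\dots,\lambda_{i,B})$, $\boldsymbol{k_i}=(k_{i,1},\dots,k_{i,B})$. For a finite signed measure $\nu$, $\|\nu\|_{tv}:=\sup\{\sum_{i=1}^n|\nu(E_i)|: E_1,\dots,E_n \text{ a finite measurable partition of the whole space}\}$. *)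

theory Defs
  imports "HOL-Probability.Probability"
begin

section \<open>Kernels and reproducing kernel Hilbert spaces\<close>

text \<open>
  Kernels on \<^term>\<open>S\<close> are total functions of which only the values on \<^term>\<open>S \<times> S\<close> matter.
\<close>

definition kernel_on :: "'a set \<Rightarrow> ('a \<Rightarrow> 'a \<Rightarrow> real) \<Rightarrow> bool" where
  "kernel_on S k \<longleftrightarrow>
     (\<forall>x\<in>S. \<forall>y\<in>S. k x y = k y x) \<and>
     (\<forall>n (x :: nat \<Rightarrow> 'a) (a :: nat \<Rightarrow> real). (\<forall>i<n. x i \<in> S) \<longrightarrow>
        0 \<le> (\<Sum>i<n. \<Sum>j<n. a i * a j * k (x i) (x j)))"

definition bounded_kernel_on :: "'a set \<Rightarrow> ('a \<Rightarrow> 'a \<Rightarrow> real) \<Rightarrow> bool" where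
  "bounded_kernel_on S k \<longleftrightarrow> bdd_above ((\<lambda>x. sqrt (k x x)) ` S)"

definition kernel_norm :: "'a set \<Rightarrow> ('a \<Rightarrow> 'a \<Rightarrow> real) \<Rightarrow> real" where
  "kernel_norm S k = (SUP x\<in>S. sqrt (k x x))"

definition measurable_kernel_on ::
    "'a :: topological_space set \<Rightarrow> ('a \<Rightarrow> 'a \<Rightarrow> real) \<Rightarrow> bool" where
  "measurable_kernel_on S k \<longleftrightarrow>
     (\<lambda>(x, y). k x y) \<in> borel_measurable (restrict_space borel S \<Otimes>\<^sub>M restrict_space borel S)"

definition zero_ext :: "'a set \<Rightarrow> ('a \<Rightarrow> real) \<Rightarrow> 'a \<Rightarrow> real" where
  "zero_ext S g = (\<lambda>x. if x \<in> S then g x else 0)"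

definition ip_norm :: "(('a \<Rightarrow> real) \<Rightarrow> ('a \<Rightarrow> real) \<Rightarrow> real) \<Rightarrow> ('a \<Rightarrow> real) \<Rightarrow> real" where
  "ip_norm ip f = sqrt (ip f f)"

text \<open>
  \<^term>\<open>ip\<close> is unconstrained outside of \<^term>\<open>H\<close>, whereas \<^const>\<open>Metric_space\<close> requires
  symmetry and nonnegativity everywhere; hence the case distinction.
\<close>

definition ip_dist ::
    "('a \<Rightarrow> real) set \<Rightarrow> (('a \<Rightarrow> real) \<Rightarrow> ('a \<Rightarrow> real) \<Rightarrow> real) \<Rightarrow>
     ('a \<Rightarrow> real) \<Rightarrow> ('a \<Rightarrow> real) \<Rightarrow> real" where
  "ip_dist H ip f g = (if f \<in> H \<and> g \<in> H then ip_norm ip (\<lambda>x. f x - g x) else 0)"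

text \<open>
  A real function on \<^term>\<open>S\<close> is represented by the total function that agrees with it on
  \<^term>\<open>S\<close> and vanishes elsewhere, so that the vector space operations are pointwise.
\<close>

locale pre_hilbert_function_space =
  fixes S :: "'a set"
    and H :: "('a \<Rightarrow> real) set"
    and ip :: "('a \<Rightarrow> real) \<Rightarrow> ('a \<Rightarrow> real) \<Rightarrow> real"
  assumes vanishes: "\<And>f x. f \<in> H \<Longrightarrow> x \<notin> S \<Longrightarrow> f x = 0"
    and zero_mem: "(\<lambda>x. 0) \<in> H"
    and add_mem: "\<And>f g. f \<in> H \<Longrightarrow> g \<in> H \<Longrightarrow> (\<lambda>x. f x + g x) \<in> H"
    and scale_mem: "\<And>f c. f \<in> H \<Longrightarrow> (\<lambda>x. c * f x) \<in> H"
    and ip_commute: "\<And>f g. f \<in> H \<Longrightarrow> g \<in> H \<Longrightarrow> ip f g = ip g f"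
    and ip_add: "\<And>f g h. f \<in> H \<Longrightarrow> g \<in> H \<Longrightarrow> h \<in> H \<Longrightarrow>
                   ip (\<lambda>x. f x + g x) h = ip f h + ip g h"
    and ip_scale: "\<And>f g c. f \<in> H \<Longrightarrow> g \<in> H \<Longrightarrow> ip (\<lambda>x. c * f x) g = c * ip f g"
    and ip_nonneg: "\<And>f. f \<in> H \<Longrightarrow> 0 \<le> ip f f"
    and ip_definite: "\<And>f. f \<in> H \<Longrightarrow> ip f f = 0 \<Longrightarrow> f = (\<lambda>x. 0)"
begin

lemma diff_mem: "f \<in> H \<Longrightarrow> g \<in> H \<Longrightarrow> (\<lambda>x. f x - g x) \<in> H"
  using add_mem[OF _ scale_mem[of g "-1"], of f] by simp

lemma ip_square:
  assumes "f \<in> H" "g \<in> H"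
  shows "ip (\<lambda>x. f x + c * g x) (\<lambda>x. f x + c * g x) = ip f f + 2 * c * ip f g + c\<^sup>2 * ip g g"
proof -
  note m = assms scale_mem[OF assms(2), of c]
  note n = add_mem[OF m(1) m(3)]
  have f: "ip f (\<lambda>x. f x + c * g x) = ip f f + c * ip f g"
    using ip_commute[OF m(1) n] ip_add[OF m(1) m(3) m(1)] ip_scale[OF m(2) m(1), of c]
      ip_commute[OF m(1) m(2)] by simp
  have g: "ip g (\<lambda>x. f x + c * g x) = ip f g + c * ip g g"
    using ip_commute[OF m(2) n] ip_add[OF m(1) m(3) m(2)] ip_scale[OF m(2) m(2), of c] by simp
  show ?thesis
    using ip_add[OF m(1) m(3) n] ip_scale[OF m(2) n, of c] f g
    by (simp add: power2_eq_square algebra_simps)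
qed

lemma cauchy_schwarz:
  assumes "f \<in> H" "g \<in> H"
  shows "ip f g \<le> ip_norm ip f * ip_norm ip g"
proof (cases "ip g g = 0")
  case True
  then have "g = (\<lambda>x. 0)" using ip_definite assms by blast
  then have "ip g f = 0" using ip_scale[OF zero_mem assms(1), of 0] by simp
  then show ?thesis using ip_commute[OF assms] True by (simp add: ip_norm_def)
next
  case False
  then have pos: "ip g g > 0" using ip_nonneg[OF assms(2)] by simp
  let ?c = "- ip f g / ip g g"
  have "0 \<le> ip f f + 2 * ?c * ip f g + ?c\<^sup>2 * ip g g"
    using ip_nonneg[OF add_mem[OF assms(1) scale_mem[OF assms(2), of ?c]]]
    by (simp only: ip_square[OF assms])
  also have "\<dots> = ip f f - (ip f g)\<^sup>2 / ip g g"
    using pos by (simp add: power2_eq_square field_simps)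
  finally have "(ip f g)\<^sup>2 \<le> ip f f * ip g g"
    using pos by (simp add: field_simps)
  then have "\<bar>ip f g\<bar> \<le> sqrt (ip f f * ip g g)"
    using real_le_rsqrt[of "\<bar>ip f g\<bar>"] by simp
  then show ?thesis by (simp add: ip_norm_def real_sqrt_mult)
qed

lemma ip_norm_triangle:
  assumes "f \<in> H" "g \<in> H"
  shows "ip_norm ip (\<lambda>x. f x + g x) \<le> ip_norm ip f + ip_norm ip g"
proof -
  have "ip (\<lambda>x. f x + g x) (\<lambda>x. f x + g x) = ip f f + 2 * ip f g + ip g g"
    using ip_square[OF assms, of 1] by simp
  also have "\<dots> \<le> (ip_norm ip f + ip_norm ip g)\<^sup>2"
    using cauchy_schwarz[OF assms] ip_nonneg assms
    by (simp add: ip_norm_def power2_sum)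
  finally show ?thesis
    using ip_nonneg assms by (simp add: ip_norm_def real_le_lsqrt)
qed

lemma Metric_space_ip_dist: "Metric_space H (ip_dist H ip)"
proof
  show "0 \<le> ip_dist H ip f g" for f g
    by (auto simp: ip_dist_def ip_norm_def intro: ip_nonneg diff_mem)
  show "ip_dist H ip f g = ip_dist H ip g f" for f g
  proof (cases "f \<in> H \<and> g \<in> H")
    case True
    have "ip (\<lambda>x. - (g x - f x)) (\<lambda>x. - (g x - f x)) = ip (\<lambda>x. g x - f x) (\<lambda>x. g x - f x)"
      using ip_square[OF zero_mem diff_mem[of g f], of "-1"] True
        ip_scale[OF zero_mem zero_mem, of 0] ip_scale[OF zero_mem diff_mem[of g f], of 0]
      by simp
    then show ?thesis by (simp add: ip_dist_def ip_norm_def)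
  qed (auto simp: ip_dist_def)
  show "ip_dist H ip f g = 0 \<longleftrightarrow> f = g" if "f \<in> H" "g \<in> H" for f g
  proof
    assume "ip_dist H ip f g = 0"
    then have "(\<lambda>x. f x - g x) = (\<lambda>x. 0)"
      using that ip_definite[OF diff_mem[OF that]] by (simp add: ip_dist_def ip_norm_def)
    then show "f = g" by (simp add: fun_eq_iff)
  next
    assume "f = g"
    then show "ip_dist H ip f g = 0"
      using ip_scale[OF zero_mem zero_mem, of 0] that by (simp add: ip_dist_def ip_norm_def)
  qed
  show "ip_dist H ip f h \<le> ip_dist H ip f g + ip_dist H ip g h"
    if "f \<in> H" "g \<in> H" "h \<in> H" for f g h
    using ip_norm_triangle[OF diff_mem[OF that(1,2)] diff_mem[OF that(2,3)]] that
    by (simp add: ip_dist_def)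
qed

end

locale rkhs = pre_hilbert_function_space S H ip
  for S :: "'a set" and k :: "'a \<Rightarrow> 'a \<Rightarrow> real" and H ip +
  assumes complete: "Metric_space.mcomplete H (ip_dist H ip)"
    and section_mem: "\<And>x. x \<in> S \<Longrightarrow> zero_ext S (\<lambda>y. k y x) \<in> H"
    and reproducing: "\<And>f x. f \<in> H \<Longrightarrow> x \<in> S \<Longrightarrow> f x = ip f (zero_ext S (\<lambda>y. k y x))"

definition separable_rkhs ::
    "('a \<Rightarrow> real) set \<Rightarrow> (('a \<Rightarrow> real) \<Rightarrow> ('a \<Rightarrow> real) \<Rightarrow> real) \<Rightarrow> bool" where
  "separable_rkhs H ip \<longleftrightarrow> separable_space (Metric_space.mtopology H (ip_dist H ip))"


section \<open>Loss functions\<close>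

text \<open>
  The label space is a set \<^term>\<open>Y\<close> of reals; the values of \<^term>\<open>L x y t\<close> for
  \<^term>\<open>y \<notin> Y\<close> do not matter.
\<close>

definition loss_function ::
    "real set \<Rightarrow> ('a :: topological_space \<Rightarrow> real \<Rightarrow> real \<Rightarrow> real) \<Rightarrow> bool" where
  "loss_function Y L \<longleftrightarrow>
     (\<lambda>(x, y, t). L x y t) \<in> borel_measurable (restrict_space borel (UNIV \<times> Y \<times> UNIV)) \<and>
     (\<forall>x. \<forall>y\<in>Y. \<forall>t. 0 \<le> L x y t)"

definition convex_loss :: "real set \<Rightarrow> ('a \<Rightarrow> real \<Rightarrow> real \<Rightarrow> real) \<Rightarrow> bool" where
  "convex_loss Y L \<longleftrightarrow> (\<forall>x. \<forall>y\<in>Y. convex_on UNIV (L x y))"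

definition lipschitz_loss_with :: "real \<Rightarrow> real set \<Rightarrow> ('a \<Rightarrow> real \<Rightarrow> real \<Rightarrow> real) \<Rightarrow> bool" where
  "lipschitz_loss_with c Y L \<longleftrightarrow> 0 \<le> c \<and> (\<forall>x. \<forall>y\<in>Y. c-lipschitz_on UNIV (L x y))"

definition lipschitz_loss :: "real set \<Rightarrow> ('a \<Rightarrow> real \<Rightarrow> real \<Rightarrow> real) \<Rightarrow> bool" where
  "lipschitz_loss Y L \<longleftrightarrow> (\<exists>c. lipschitz_loss_with c Y L)"

definition lipschitz_const :: "real set \<Rightarrow> ('a \<Rightarrow> real \<Rightarrow> real \<Rightarrow> real) \<Rightarrow> real" where
  "lipschitz_const Y L = Inf {c. lipschitz_loss_with c Y L}"

definition shifted_loss :: "('a \<Rightarrow> real \<Rightarrow> real \<Rightarrow> real) \<Rightarrow> 'a \<Rightarrow> real \<Rightarrow> real \<Rightarrow> real" where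
  "shifted_loss L x y t = L x y t - L x y 0"


section \<open>Measures\<close>

definition local_measure ::
    "real set \<Rightarrow> ('a \<times> real) measure \<Rightarrow> 'a set \<Rightarrow> ('a \<times> real) measure" where
  "local_measure Y P S = scale_measure (1 / emeasure P (S \<times> Y)) (restrict_space P (S \<times> Y))"

definition marginal ::
    "'a :: topological_space set \<Rightarrow> ('a \<times> real) measure \<Rightarrow> 'a measure" where
  "marginal S Q = distr Q (restrict_space borel S) fst"

text \<open>Finite signed measures are given by their values \<^term>\<open>\<nu>\<close> on the measurable sets of
  \<^term>\<open>M\<close>.\<close>

definition tv_norm :: "'a measure \<Rightarrow> ('a set \<Rightarrow> real) \<Rightarrow> real" where
  "tv_norm M \<nu> =
     Sup {\<Sum>E\<in>\<E>. \<bar>\<nu> E\<bar> | \<E>. finite \<E> \<and> \<E> \<subseteq> sets M \<and> partition_on (space M) \<E>}"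

text \<open>Meaningful for measurable \<^term>\<open>f\<close> with finite \<^term>\<open>p\<close>-th absolute moment, in
  particular for bounded measurable functions under a finite measure.\<close>

definition Lp_norm :: "real \<Rightarrow> 'a measure \<Rightarrow> ('a \<Rightarrow> real) \<Rightarrow> real" where
  "Lp_norm p M f = (\<integral>x. \<bar>f x\<bar> powr p \<partial>M) powr (1 / p)"


section \<open>Support vector machines\<close>

definition svm ::
    "('a \<Rightarrow> real \<Rightarrow> real \<Rightarrow> real) \<Rightarrow> ('a \<times> real) measure \<Rightarrow> real \<Rightarrow>
     ('a \<Rightarrow> real) set \<Rightarrow> (('a \<Rightarrow> real) \<Rightarrow> ('a \<Rightarrow> real) \<Rightarrow> real) \<Rightarrow> 'a \<Rightarrow> real" where
  "svm L Q \<Lambda> H ip =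
     arg_min_on (\<lambda>f. (\<integral>(x, y). shifted_loss L x y (f x) \<partial>Q) + \<Lambda> * (ip_norm ip f)\<^sup>2) H"

definition localized_svm ::
    "real set \<Rightarrow> ('a \<Rightarrow> real \<Rightarrow> real \<Rightarrow> real) \<Rightarrow> nat \<Rightarrow> (nat \<Rightarrow> 'a set) \<Rightarrow> (nat \<Rightarrow> 'a \<Rightarrow> real) \<Rightarrow>
     ('a \<times> real) measure \<Rightarrow> (nat \<Rightarrow> real) \<Rightarrow> (nat \<Rightarrow> ('a \<Rightarrow> real) set) \<Rightarrow>
     (nat \<Rightarrow> ('a \<Rightarrow> real) \<Rightarrow> ('a \<Rightarrow> real) \<Rightarrow> real) \<Rightarrow> 'a \<Rightarrow> real" where
  "localized_svm Y L B X w P \<Lambda> H ip x =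
     (\<Sum>b=1..B. w b x * zero_ext (X b) (svm L (local_measure Y P (X b)) (\<Lambda> b) (H b) (ip b)) x)"

end

theory Submission
  imports Defs
begin

text \<open>
  Minkowski's inequality reduces the claim to a single region. There the two local SVMs are compared
  through the SVM for the measure and regularization parameter of the first and the kernel of the
  second. For a fixed kernel, adding the strong convexity inequalities of the two objectives at
  their minimizers bounds the RKHS norm of the difference. For a fixed measure, the SVM of
  \<open>k\<^sub>2\<close> is \<open>- E (h k\<^sub>2(X, \<cdot>)) / (2 \<Lambda>)\<close> with \<open>h\<close> a derivative of the loss, and
  \<open>- E (h k\<^sub>1(X, \<cdot>)) / (2 \<Lambda>)\<close> is an element of the RKHS of \<open>k\<^sub>1\<close> that is close to it in \<open>L\<^sub>p\<close> and
  close to the SVM of \<open>k\<^sub>1\<close> in RKHS norm. The derivative becomes available by smoothing the loss,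
  and the smoothing parameter tends to zero at the end.
\<close>

section \<open>Regularized minimization in a reproducing kernel Hilbert space\<close>

text \<open>SVMs for two different kernels live in different spaces \<open>H1\<close> and
  \<open>H2\<close>, so neither can be inserted into the other's objective and strong convexity
  cannot compare them directly. The remedy is an element \<open>g\<close> of \<open>H1\<close> that
  solves the same first-order equation as the SVM in \<open>H2\<close>, with the same weight
  \<open>h\<close>. Its difference from that SVM is linear in the kernel difference
  \<open>D\<close>, with the factor \<open>1 / (2 * \<Lambda>)\<close> of the equation. Its distance
  to the SVM in \<open>H1\<close> comes from the excess of the objective at \<open>g\<close>. This
  excess is linear in \<open>D\<close> too, but it bounds the square of an RKHS norm; hence the term
  with \<open>sqrt D\<close>. Changes of measure and of regularization parameter are estimated
  uniformly in \<open>x\<close>, and so their terms do not depend on \<open>p\<close>.\<close>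

context pre_hilbert_function_space
begin

lemma ip_add_right:
  "f \<in> H \<Longrightarrow> g \<in> H \<Longrightarrow> h \<in> H \<Longrightarrow> ip h (\<lambda>x. f x + g x) = ip h f + ip h g"
  by (simp add: ip_commute[of h] add_mem ip_add)

lemma ip_scale_right: "f \<in> H \<Longrightarrow> g \<in> H \<Longrightarrow> ip g (\<lambda>x. c * f x) = c * ip g f"
  by (simp add: ip_commute[of g] scale_mem ip_scale)

lemma ip_diff:
  "f \<in> H \<Longrightarrow> g \<in> H \<Longrightarrow> h \<in> H \<Longrightarrow> ip (\<lambda>x. f x - g x) h = ip f h - ip g h"
  using ip_add[of f "\<lambda>x. - 1 * g x" h] ip_scale[of g h "- 1"] scale_mem[of g "- 1"] by simp

lemma ip_diff_right:
  "f \<in> H \<Longrightarrow> g \<in> H \<Longrightarrow> h \<in> H \<Longrightarrow> ip h (\<lambda>x. f x - g x) = ip h f - ip h g"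
  by (simp add: ip_commute[of h] diff_mem ip_diff)

lemma ip_norm_nonneg: "f \<in> H \<Longrightarrow> 0 \<le> ip_norm ip f"
  by (simp add: ip_norm_def ip_nonneg)

lemma ip_norm_square: "f \<in> H \<Longrightarrow> (ip_norm ip f)\<^sup>2 = ip f f"
  by (simp add: ip_norm_def ip_nonneg)

lemma ip_norm_zero: "ip_norm ip (\<lambda>x. 0) = 0"
  using ip_scale[OF zero_mem zero_mem, of 0] by (simp add: ip_norm_def)

lemma ip_norm_scale: "f \<in> H \<Longrightarrow> ip_norm ip (\<lambda>x. c * f x) = \<bar>c\<bar> * ip_norm ip f"
  by (simp add: ip_norm_def ip_scale ip_scale_right scale_mem real_sqrt_mult
      flip: mult.assoc power2_eq_square)

lemma abs_ip_le:
  assumes "f \<in> H" "g \<in> H"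
  shows "\<bar>ip f g\<bar> \<le> ip_norm ip f * ip_norm ip g"
proof -
  have "ip (\<lambda>x. - 1 * f x) g \<le> ip_norm ip (\<lambda>x. - 1 * f x) * ip_norm ip g"
    using assms by (intro cauchy_schwarz scale_mem)
  then show ?thesis
    using assms cauchy_schwarz[OF assms] ip_scale[OF assms, of "- 1"] ip_norm_scale[OF assms(1), of "- 1"]
    by simp
qed

lemma ip_norm_diff_commute:
  assumes "f \<in> H" "g \<in> H"
  shows "ip_norm ip (\<lambda>x. f x - g x) = ip_norm ip (\<lambda>x. g x - f x)"
  using ip_norm_scale[OF diff_mem[OF assms(2,1)], of "-1"] by simp

lemma ip_norm_abs_diff_le:
  assumes "f \<in> H" "g \<in> H"
  shows "\<bar>ip_norm ip f - ip_norm ip g\<bar> \<le> ip_norm ip (\<lambda>x. f x - g x)"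
proof -
  have "ip_norm ip f \<le> ip_norm ip (\<lambda>x. f x - g x) + ip_norm ip g" 
    using ip_norm_triangle[OF diff_mem[OF assms] assms(2)] by simp
  moreover have "ip_norm ip g \<le> ip_norm ip (\<lambda>x. g x - f x) + ip_norm ip f" 
    using ip_norm_triangle[OF diff_mem[OF assms(2,1)] assms(1)] by simp
  ultimately show ?thesis
    using ip_norm_diff_commute[OF assms] by simp
qed

lemma convex_combination_mem:
  assumes "f \<in> H" "g \<in> H"
  shows "(\<lambda>x. (1 - t) * f x + t * g x) \<in> H"
  using assms by (intro add_mem scale_mem)

text \<open>The last, negative term is the strong convexity of the squared norm; existence, the gap
  inequality and the stability estimates all draw on it.\<close>

lemma ip_norm_square_convex_combination:
  assumes "f \<in> H" "g \<in> H"
  shows "(ip_norm ip (\<lambda>x. (1 - t) * f x + t * g x))\<^sup>2 =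
    (1 - t) * (ip_norm ip f)\<^sup>2 + t * (ip_norm ip g)\<^sup>2
      - t * (1 - t) * (ip_norm ip (\<lambda>x. g x - f x))\<^sup>2"
proof -
  note d = diff_mem[OF assms(2,1)]
  have eq: "(\<lambda>x. (1 - t) * f x + t * g x) = (\<lambda>x. f x + t * (g x - f x))"
    by (simp add: algebra_simps)
  have "ip f (\<lambda>x. g x - f x) = ip f g - ip f f"
    using assms by (simp add: ip_diff_right)
  moreover have "ip (\<lambda>x. g x - f x) (\<lambda>x. g x - f x) = ip g g - 2 * ip f g + ip f f"
    using assms by (simp add: ip_diff ip_diff_right diff_mem ip_commute[of g f])
  ultimately show ?thesis
    using assms unfolding ip_norm_square[OF convex_combination_mem[OF assms]] unfolding eq ip_square[OF assms(1) d]
    by (simp add: ip_norm_square d) (simp add: power2_eq_square algebra_simps)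
qed

text \<open>A minimizing sequence is Cauchy, because the quadratic term makes the objective strongly
  convex.\<close>

lemma ex_regularized_minimizer:
  fixes R :: "('a \<Rightarrow> real) \<Rightarrow> real"
  assumes complete: "Metric_space.mcomplete H (ip_dist H ip)"
    and "\<Lambda> > 0" and V: "V \<subseteq> H" and zero: "(\<lambda>x. 0) \<in> V"
    and combination: "\<And>f g t. f \<in> V \<Longrightarrow> g \<in> V \<Longrightarrow> (\<lambda>x. (1 - t) * f x + t * g x) \<in> V"
    and closed: "\<And>f s. \<lbrakk>\<And>n. s n \<in> V; f \<in> H; (\<lambda>n. ip_norm ip (\<lambda>x. s n x - f x)) \<longlonglongrightarrow> 0\<rbrakk> \<Longrightarrow> f \<in> V"
    and lipschitz: "\<And>f g. f \<in> V \<Longrightarrow> g \<in> V \<Longrightarrow> \<bar>R f - R g\<bar> \<le> a * ip_norm ip (\<lambda>x. f x - g x)"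
    and convex: "\<And>f g t. f \<in> V \<Longrightarrow> g \<in> V \<Longrightarrow> 0 \<le> t \<Longrightarrow> t \<le> 1 \<Longrightarrow>
       R (\<lambda>x. (1 - t) * f x + t * g x) \<le> (1 - t) * R f + t * R g"
  shows "\<exists>f\<in>V. \<forall>g\<in>V. R f + \<Lambda> * (ip_norm ip f)\<^sup>2 \<le> R g + \<Lambda> * (ip_norm ip g)\<^sup>2"
proof -
  interpret M: Metric_space H "ip_dist H ip" by (rule Metric_space_ip_dist)
  define J where "J f = R f + \<Lambda> * (ip_norm ip f)\<^sup>2" for f
  define m where "m = Inf (J ` V)"
  \<comment> \<open>\<open>a\<^sup>2 / (4 * \<Lambda>)\<close> is the maximum of
    \<open>a * r - \<Lambda> * r\<^sup>2\<close> over real \<open>r\<close>: the risk decreases at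
    most linearly in the norm and the penalty outweighs it.\<close>
  have lower: "R (\<lambda>x. 0) - a\<^sup>2 / (4 * \<Lambda>) \<le> J g" if "g \<in> V" for g
  proof -
    have "R (\<lambda>x. 0) - R g \<le> a * ip_norm ip g"
      using lipschitz[OF that zero] by simp
    moreover have "a * ip_norm ip g \<le> \<Lambda> * (ip_norm ip g)\<^sup>2 + a\<^sup>2 / (4 * \<Lambda>)"
    proof -
      have "0 \<le> (2 * \<Lambda> * ip_norm ip g - a)\<^sup>2" by simp
      then show ?thesis using \<open>\<Lambda> > 0\<close>
        by (simp add: field_simps power2_eq_square)
    qed
    ultimately show ?thesis by (simp add: J_def)
  qed
  have bdd: "bdd_below (J ` V)" using lower by (rule bdd_belowI2)
  have m_le: "m \<le> J g" if "g \<in> V" for g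
    unfolding m_def using that by (intro cInf_lower bdd imageI)
  have "\<exists>g\<in>V. J g < m + 1 / real (Suc n)" for n
  proof -
    have "\<exists>y\<in>J ` V. y < m + 1 / real (Suc n)"
      using cInf_less_iff[of "J ` V" "m + 1 / real (Suc n)"] zero bdd by (auto simp: m_def)
    then show ?thesis by auto
  qed
  then obtain s where s: "\<And>n. s n \<in> V" "\<And>n. J (s n) < m + 1 / real (Suc n)" by metis
  have sH: "s n \<in> H" for n using s V by auto
  \<comment> \<open>The midpoint of two near-minimizers still has objective at least
    \<open>m\<close>. The factor \<open>\<Lambda> / 4\<close> is
    \<open>\<Lambda> * t * (1 - t)\<close> at \<open>t = 1/2\<close>.\<close>
  have close: "\<Lambda> / 4 * (ip_norm ip (\<lambda>x. s j x - s n x))\<^sup>2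
      \<le> (1 / real (Suc n) + 1 / real (Suc j)) / 2" for n j
  proof -
    have "m \<le> J (\<lambda>x. (1 - 1/2) * s n x + 1/2 * s j x)"
      by (intro m_le combination s)
    also have "\<dots> \<le> J (s n) / 2 + J (s j) / 2 - \<Lambda> / 4 * (ip_norm ip (\<lambda>x. s j x - s n x))\<^sup>2"
      using convex[OF s(1)[of n] s(1)[of j], of "1/2"] \<open>\<Lambda> > 0\<close>
      unfolding J_def ip_norm_square_convex_combination[OF sH sH] by (simp add: field_simps)
    finally have "\<Lambda> / 4 * (ip_norm ip (\<lambda>x. s j x - s n x))\<^sup>2 \<le> J (s n) / 2 + J (s j) / 2 - m"
      by simp
    also have "\<dots> \<le> (1 / real (Suc n) + 1 / real (Suc j)) / 2"
      using s(2)[of n] s(2)[of j] by argo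
    finally show ?thesis .
  qed
  have "M.MCauchy s"
    unfolding M.MCauchy_def
  proof safe
    fix e :: real assume "e > 0"
    then obtain N where N: "1 / real (Suc N) < \<Lambda> / 4 * e\<^sup>2"
      using \<open>\<Lambda> > 0\<close> reals_Archimedean[of "\<Lambda> / 4 * e\<^sup>2"] by (auto simp: inverse_eq_divide)
    have "ip_dist H ip (s n) (s j) < e" if "N \<le> n" "N \<le> j" for n j
    proof -
      have "1 / real (Suc n) \<le> 1 / real (Suc N)" "1 / real (Suc j) \<le> 1 / real (Suc N)"
        using that by (auto intro!: divide_left_mono)
      then have "\<Lambda> / 4 * (ip_norm ip (\<lambda>x. s n x - s j x))\<^sup>2 < \<Lambda> / 4 * e\<^sup>2"
        using close[of n j] N by argo
      then have "(ip_norm ip (\<lambda>x. s n x - s j x))\<^sup>2 < e\<^sup>2"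
        using \<open>\<Lambda> > 0\<close> by simp
      then show ?thesis
        using \<open>e > 0\<close> sH by (simp add: ip_dist_def power_less_imp_less_base)
    qed
    then show "\<exists>N. \<forall>n n'. N \<le> n \<longrightarrow> N \<le> n' \<longrightarrow> ip_dist H ip (s n) (s n') < e" by blast
  qed (use sH in auto)
  then obtain f where "limitin M.mtopology s f sequentially"
    using complete unfolding M.mcomplete_def by blast
  then have f: "f \<in> H" and "(\<lambda>n. ip_dist H ip (s n) f) \<longlonglongrightarrow> 0"
    by (auto simp: M.limitin_metric_dist_null)
  then have lim: "(\<lambda>n. ip_norm ip (\<lambda>x. s n x - f x)) \<longlonglongrightarrow> 0"
    using sH by (simp add: ip_dist_def)
  have fV: "f \<in> V" using closed[OF s(1) f lim] .
  have "(\<lambda>n. R (s n) - R f) \<longlonglongrightarrow> 0"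
  proof (rule Lim_null_comparison)
    show "(\<lambda>n. a * ip_norm ip (\<lambda>x. s n x - f x)) \<longlonglongrightarrow> 0"
      using tendsto_mult_left[OF lim, of a] by simp
  qed (use lipschitz[OF s(1) fV] in auto)
  then have R: "(\<lambda>n. R (s n)) \<longlonglongrightarrow> R f" by (rule LIM_zero_cancel)
  have "(\<lambda>n. ip_norm ip (s n) - ip_norm ip f) \<longlonglongrightarrow> 0"
    by (rule Lim_null_comparison[OF _ lim]) (use ip_norm_abs_diff_le[OF sH f] in auto)
  then have N: "(\<lambda>n. ip_norm ip (s n)) \<longlonglongrightarrow> ip_norm ip f" by (rule LIM_zero_cancel)
  have "(\<lambda>n. J (s n)) \<longlonglongrightarrow> J f"
    unfolding J_def by (intro tendsto_intros R N)
  moreover have "(\<lambda>n. m + 1 / real (Suc n)) \<longlonglongrightarrow> m + 0"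
    by (intro tendsto_intros LIMSEQ_Suc[OF lim_1_over_n])
  ultimately have "J f \<le> m + 0"
    by (rule LIMSEQ_le) (use s(2) less_imp_le in blast)
  then show ?thesis using fV m_le unfolding J_def by force
qed

text \<open>Minimality is tested on the segment from \<open>f\<close> to \<open>g\<close>. Division
  by \<open>t\<close> leaves the factor \<open>1 - t\<close>, which tends to 1 as \<open>t\<close>
  tends to 0; stopping at the midpoint would lose half of the constant.\<close>

lemma regularized_minimizer_gap:
  fixes R :: "('a \<Rightarrow> real) \<Rightarrow> real"
  assumes "\<Lambda> > 0" and f: "f \<in> H" and g: "g \<in> H"
    and min: "\<And>g. g \<in> H \<Longrightarrow> R f + \<Lambda> * (ip_norm ip f)\<^sup>2 \<le> R g + \<Lambda> * (ip_norm ip g)\<^sup>2"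
    and convex: "\<And>t. 0 \<le> t \<Longrightarrow> t \<le> 1 \<Longrightarrow>
       R (\<lambda>x. (1 - t) * f x + t * g x) \<le> (1 - t) * R f + t * R g"
  shows "\<Lambda> * (ip_norm ip (\<lambda>x. g x - f x))\<^sup>2 \<le>
    (R g + \<Lambda> * (ip_norm ip g)\<^sup>2) - (R f + \<Lambda> * (ip_norm ip f)\<^sup>2)"
proof -
  let ?n = "(ip_norm ip (\<lambda>x. g x - f x))\<^sup>2"
  let ?d = "(R g + \<Lambda> * (ip_norm ip g)\<^sup>2) - (R f + \<Lambda> * (ip_norm ip f)\<^sup>2)"
  have "(1 - t) * (\<Lambda> * ?n) \<le> ?d" if t: "0 < t" "t \<le> 1" for t
  proof -
    have "R f + \<Lambda> * (ip_norm ip f)\<^sup>2 \<le>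
        R (\<lambda>x. (1 - t) * f x + t * g x) + \<Lambda> * (ip_norm ip (\<lambda>x. (1 - t) * f x + t * g x))\<^sup>2"
      by (intro min convex_combination_mem f g)
    then have "0 \<le> t * (?d - (1 - t) * (\<Lambda> * ?n))"
      using convex[of t] t unfolding ip_norm_square_convex_combination[OF f g]
      by (simp add: algebra_simps)
    then show ?thesis using t by (simp add: zero_le_mult_iff)
  qed
  note * = this
  have "((\<lambda>t. (1 - t) * (\<Lambda> * ?n)) \<longlongrightarrow> (1 - 0) * (\<Lambda> * ?n)) (at_right 0)"
    by (intro tendsto_intros)
  then have "(1 - 0) * (\<Lambda> * ?n) \<le> ?d"
  proof (rule tendsto_upperbound)
    show "\<forall>\<^sub>F t in at_right 0. (1 - t) * (\<Lambda> * ?n) \<le> ?d"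
      using eventually_at_right_real[of 0 "1::real"] by (rule eventually_mono) (use * in auto)
  qed simp
  then show ?thesis by simp
qed

text \<open>A quadratic polynomial that is nonnegative everywhere and vanishes at 0 has no linear
  term. The one-sided expansion takes the place of differentiability of \<open>R\<close>, and its
  constant \<open>C\<close> leaves no trace in the conclusion.\<close>

lemma regularized_minimizer_first_order:
  fixes R :: "('a \<Rightarrow> real) \<Rightarrow> real"
  assumes f: "f \<in> H" and v: "v \<in> H"
    and min: "\<And>g. g \<in> V \<Longrightarrow> R f + \<Lambda> * (ip_norm ip f)\<^sup>2 \<le> R g + \<Lambda> * (ip_norm ip g)\<^sup>2"
    and line: "\<And>t. (\<lambda>x. f x + t * v x) \<in> V"
    and expansion: "\<And>t. R (\<lambda>x. f x + t * v x) \<le> R f + t * l + C * t\<^sup>2"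
  shows "2 * \<Lambda> * ip f v = - l"
proof -
  let ?D = "C + \<Lambda> * ip v v"
  have key: "0 \<le> t * (l + 2 * \<Lambda> * ip f v) + t\<^sup>2 * ?D" for t
  proof -
    have "R f + \<Lambda> * ip f f \<le> R (\<lambda>x. f x + t * v x) + \<Lambda> * ip (\<lambda>x. f x + t * v x) (\<lambda>x. f x + t * v x)"
      using min[OF line[of t]] f v by (simp add: ip_norm_square add_mem scale_mem)
    then show ?thesis
      using expansion[of t] unfolding ip_square[OF f v] by (simp add: algebra_simps)
  qed
  define e where "e = l + 2 * \<Lambda> * ip f v"
  have "e = 0"
  proof (rule ccontr)
    assume "e \<noteq> 0"
    \<comment> \<open>Since \<open>D\<close> is positive and strictly above the quadratic
      coefficient, the polynomial would be negative at \<open>t = - e / D\<close>.\<close>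
    define D where "D = \<bar>?D\<bar> + 1"
    have D: "D > 0" "?D < D" by (auto simp: D_def)
    have "0 \<le> (- e / D) * e + (- e / D)\<^sup>2 * ?D"
      using key[of "- e / D"] by (simp add: e_def)
    also have "\<dots> < (- e / D) * e + (- e / D)\<^sup>2 * D"
      using \<open>e \<noteq> 0\<close> D by (intro add_strict_left_mono mult_strict_left_mono) auto
    also have "\<dots> = 0" using D by (simp add: power2_eq_square field_simps)
    finally show False by simp
  qed
  then show ?thesis by (simp add: e_def)
qed

end

section \<open>Point evaluation and measurability of RKHS elements\<close>

context rkhs
begin

lemma ip_norm_section:
  assumes "x \<in> S" shows "ip_norm ip (zero_ext S (\<lambda>y. k y x)) = sqrt (k x x)"
  using reproducing[OF section_mem[OF assms] assms] assms by (simp add: ip_norm_def zero_ext_def)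

lemma abs_le_ip_norm:
  assumes "f \<in> H" "x \<in> S" shows "\<bar>f x\<bar> \<le> ip_norm ip f * sqrt (k x x)"
  using abs_ip_le[OF assms(1) section_mem[OF assms(2)]] reproducing[OF assms] ip_norm_section[OF assms(2)]
  by simp

lemma tendsto_of_ip_norm_tendsto:
  assumes s: "\<And>n. s n \<in> H" and f: "f \<in> H" and lim: "(\<lambda>n. ip_norm ip (\<lambda>x. s n x - f x)) \<longlonglongrightarrow> 0"
  shows "(\<lambda>n. s n x) \<longlonglongrightarrow> f x"
proof (cases "x \<in> S")
  case True
  have "(\<lambda>n. s n x - f x) \<longlonglongrightarrow> 0"
  proof (rule Lim_null_comparison)
    show "(\<lambda>n. ip_norm ip (\<lambda>x. s n x - f x) * sqrt (k x x)) \<longlonglongrightarrow> 0"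
      using tendsto_mult_right[OF lim] by simp
    show "\<forall>\<^sub>F n in sequentially. norm (s n x - f x) \<le> ip_norm ip (\<lambda>x. s n x - f x) * sqrt (k x x)"
      using abs_le_ip_norm[OF diff_mem[OF s f] True] by simp
  qed
  then show ?thesis by (rule LIM_zero_cancel)
next
  case False
  then show ?thesis using vanishes[OF s False] vanishes[OF f False] by simp
qed

text \<open>The measurable elements form a closed subspace containing all kernel sections, so the
  projection onto it is the identity.\<close>

lemma measurable_mem:
  assumes sections: "\<And>x. x \<in> S \<Longrightarrow> zero_ext S (\<lambda>y. k y x) \<in> borel_measurable N"
    and f: "f \<in> H"
  shows "f \<in> borel_measurable N"
proof -
  define V where "V = H \<inter> borel_measurable N"
  \<comment> \<open>With this linear risk the objective with parameter 1 is the squared distance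
    from \<open>g\<close> to \<open>f\<close> minus \<open>ip f f\<close>, so its minimizer over
    \<open>V\<close> is the projection of \<open>f\<close>.\<close>
  define R where "R g = - 2 * ip f g" for g
  have "\<exists>g\<in>V. \<forall>h\<in>V. R g + 1 * (ip_norm ip g)\<^sup>2 \<le> R h + 1 * (ip_norm ip h)\<^sup>2"
  proof (rule ex_regularized_minimizer[where a = "2 * ip_norm ip f"])
    show "Metric_space.mcomplete H (ip_dist H ip)" by (rule complete)
    show "(\<lambda>x. 0) \<in> V" by (simp add: V_def zero_mem)
    show "(\<lambda>x. (1 - t) * g x + t * h x) \<in> V" if "g \<in> V" "h \<in> V" for g h t
      using that convex_combination_mem[of g h t] by (auto simp: V_def)
    show "g \<in> V" if "\<And>n. s n \<in> V" "g \<in> H" "(\<lambda>n. ip_norm ip (\<lambda>x. s n x - g x)) \<longlonglongrightarrow> 0" for g s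
    proof -
      have "g \<in> borel_measurable N"
        by (rule borel_measurable_LIMSEQ_real[where u = s])
          (use that tendsto_of_ip_norm_tendsto[of s g] in \<open>auto simp: V_def\<close>)
      then show ?thesis using that by (simp add: V_def)
    qed
    show "\<bar>R g - R h\<bar> \<le> 2 * ip_norm ip f * ip_norm ip (\<lambda>x. g x - h x)" if "g \<in> V" "h \<in> V" for g h
    proof -
      have gh: "g \<in> H" "h \<in> H" using that by (auto simp: V_def)
      have "R g - R h = - 2 * ip f (\<lambda>x. g x - h x)"
        using f gh by (simp add: R_def ip_diff_right)
      then show ?thesis using abs_ip_le[OF f diff_mem[OF gh]] by (simp add: abs_mult)
    qed
    show "R (\<lambda>x. (1 - t) * g x + t * h x) \<le> (1 - t) * R g + t * R h" if "g \<in> V" "h \<in> V" for g h t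
    proof -
      have gh: "g \<in> H" "h \<in> H" using that by (auto simp: V_def)
      show ?thesis
        using f gh by (simp add: R_def ip_add_right ip_scale_right scale_mem)
    qed
  qed (auto simp: V_def)
  then obtain g where g: "g \<in> V"
    and min: "\<And>h. h \<in> V \<Longrightarrow> R g + 1 * (ip_norm ip g)\<^sup>2 \<le> R h + 1 * (ip_norm ip h)\<^sup>2" by blast
  have gH: "g \<in> H" and gN: "g \<in> borel_measurable N" using g by (auto simp: V_def)
  have orth: "ip g v = ip f v" if v: "v \<in> V" for v
  proof -
    have vH: "v \<in> H" and vN: "v \<in> borel_measurable N" using v by (auto simp: V_def)
    have "2 * 1 * ip g v = - (- 2 * ip f v)"
    proof (rule regularized_minimizer_first_order[OF gH vH min])
      show "(\<lambda>x. g x + t * v x) \<in> V" for t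
        using gH gN vH vN by (auto simp: V_def intro: add_mem scale_mem)
      show "R (\<lambda>x. g x + t * v x) \<le> R g + t * (- 2 * ip f v) + 0 * t\<^sup>2" for t
        using f gH vH by (simp add: R_def ip_add_right ip_scale_right scale_mem)
    qed
    then show ?thesis by simp
  qed
  have "f x = g x" for x
  proof (cases "x \<in> S")
    case True
    have "zero_ext S (\<lambda>y. k y x) \<in> V" using sections section_mem True by (simp add: V_def)
    then show ?thesis using orth reproducing[OF f True] reproducing[OF gH True] by simp
  qed (simp add: vanishes[OF f] vanishes[OF gH])
  then have "f = g" by blast
  then show ?thesis using gN by simp
qed

end


section \<open>Norms of functions and of signed measures\<close>

lemma convex_on_abs_powr:
  fixes p :: real
  assumes "p \<ge> 1"
  shows "convex_on UNIV (\<lambda>x :: real. \<bar>x\<bar> powr p)"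
proof (intro convex_onI)
  fix t x y :: real assume t: "0 < t" "t < 1"
  \<comment> \<open>When one of the two arguments is 0, convexity reduces to
    \<open>s powr p \<le> s\<close> on the unit interval.\<close>
  have scale: "(s * a) powr p \<le> s * a powr p" if "0 \<le> s" "s \<le> 1" "0 \<le> a" for s a :: real
  proof -
    have "s powr p \<le> s"
      using that assms powr_le_one_le[of s p] by (cases "s = 0") auto
    then show ?thesis using that by (simp add: powr_mult mult_right_mono)
  qed
  have "((1 - t) * a + t * b) powr p \<le> (1 - t) * a powr p + t * b powr p" if "0 \<le> a" "0 \<le> b" for a b :: real
  proof (cases "a = 0 \<or> b = 0")
    case True
    then show ?thesis using scale[of "1 - t" a] scale[of t b] t that by auto
  next
    case False
    then show ?thesis
      using convex_onD[OF powr_convex[OF assms], of t a b] t that by simp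
  qed
  from this[of "\<bar>x\<bar>" "\<bar>y\<bar>"]
  have "((1 - t) * \<bar>x\<bar> + t * \<bar>y\<bar>) powr p \<le> (1 - t) * \<bar>x\<bar> powr p + t * \<bar>y\<bar> powr p" by simp
  moreover have "\<bar>(1 - t) * x + t * y\<bar> \<le> (1 - t) * \<bar>x\<bar> + t * \<bar>y\<bar>"
    using t abs_triangle_ineq[of "(1 - t) * x" "t * y"] by (simp add: abs_mult)
  then have "\<bar>(1 - t) * x + t * y\<bar> powr p \<le> ((1 - t) * \<bar>x\<bar> + t * \<bar>y\<bar>) powr p"
    using assms by (intro powr_mono2) auto
  ultimately show "\<bar>(1 - t) *\<^sub>R x + t *\<^sub>R y\<bar> powr p \<le> (1 - t) * \<bar>x\<bar> powr p + t * \<bar>y\<bar> powr p"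
    by simp
qed auto

lemma Lp_norm_nonneg: "0 \<le> Lp_norm p M f"
  by (simp add: Lp_norm_def)

lemma powr_powr_inverse: "p > 0 \<Longrightarrow> 0 \<le> x \<Longrightarrow> (x powr p) powr (1 / p) = (x :: real)"
  by (simp add: powr_powr)

lemma Lp_norm_powr: "p > 0 \<Longrightarrow> Lp_norm p M f powr p = (\<integral>x. \<bar>f x\<bar> powr p \<partial>M)"
  by (simp add: Lp_norm_def powr_powr)

lemma Lp_norm_le_iff:
  assumes "p > 0" "0 \<le> a"
  shows "Lp_norm p M f \<le> a \<longleftrightarrow> (\<integral>x. \<bar>f x\<bar> powr p \<partial>M) \<le> a powr p"
  using assms powr_mono2[of p "Lp_norm p M f" a] powr_mono2[of "1 / p" "\<integral>x. \<bar>f x\<bar> powr p \<partial>M" "a powr p"]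
  by (auto simp: Lp_norm_powr Lp_norm_nonneg powr_powr Lp_norm_def)

lemma Lp_norm_cmult: "p > 0 \<Longrightarrow> Lp_norm p M (\<lambda>x. a * f x) = \<bar>a\<bar> * Lp_norm p M f"
  by (simp add: Lp_norm_def abs_mult powr_mult powr_powr_inverse)

section \<open>Minkowski and Jensen inequalities for bounded functions\<close>

context finite_measure
begin

lemma integrable_abs_powr:
  fixes f :: "'a \<Rightarrow> real"
  assumes "0 \<le> p" "f \<in> borel_measurable M" "\<And>x. x \<in> space M \<Longrightarrow> \<bar>f x\<bar> \<le> C"
  shows "integrable M (\<lambda>x. \<bar>f x\<bar> powr p)"
  using assms by (intro integrable_const_bound[where B = "C powr p"] AE_I2) (auto intro!: powr_mono2)

text \<open>Integrability is asked of the dominating function alone: a non-integrable power of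
  \<open>f\<close> has Bochner integral 0, which agrees with the inequality.\<close>

lemma Lp_norm_mono:
  fixes C :: real
  assumes "0 < p" "g \<in> borel_measurable M" "\<And>x. x \<in> space M \<Longrightarrow> \<bar>g x\<bar> \<le> C"
    and "\<And>x. x \<in> space M \<Longrightarrow> \<bar>f x\<bar> \<le> \<bar>g x\<bar>"
  shows "Lp_norm p M f \<le> Lp_norm p M g"
  unfolding Lp_norm_def using assms
  by (intro powr_mono2 integral_mono' integrable_abs_powr[of p g C]) auto

text \<open>Minkowski's inequality: \<^term>\<open>f + g\<close> is a multiple of a convex combination of the
  normalized functions.\<close>

lemma Lp_norm_add_le:
  fixes C D :: real
  assumes p: "1 \<le> p"
    and f: "f \<in> borel_measurable M" "\<And>x. x \<in> space M \<Longrightarrow> \<bar>f x\<bar> \<le> C"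
    and g: "g \<in> borel_measurable M" "\<And>x. x \<in> space M \<Longrightarrow> \<bar>g x\<bar> \<le> D"
  shows "Lp_norm p M (\<lambda>x. f x + g x) \<le> Lp_norm p M f + Lp_norm p M g"
proof (rule field_le_epsilon)
  fix e :: real assume "e > 0"
  \<comment> \<open>The padding by \<open>e / 2\<close> keeps the normalizing constants positive
    even if a norm is 0.\<close>
  define a where "a = Lp_norm p M f + e / 2"
  define b where "b = Lp_norm p M g + e / 2"
  have ab: "0 < a" "0 < b" using \<open>e > 0\<close> Lp_norm_nonneg[of p M] by (auto simp: a_def b_def add_nonneg_pos)
  define t where "t = b / (a + b)"
  have t: "0 \<le> t" "t \<le> 1" "1 - t = a / (a + b)" using ab by (auto simp: t_def field_simps)
  have int: "integrable M (\<lambda>x. \<bar>f x\<bar> powr p)" "integrable M (\<lambda>x. \<bar>g x\<bar> powr p)"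
    using p f g by (auto intro!: integrable_abs_powr)
  have pointwise: "\<bar>f x + g x\<bar> powr p \<le>
      (a + b) powr p * ((1 - t) * (\<bar>f x\<bar> powr p / a powr p) + t * (\<bar>g x\<bar> powr p / b powr p))" for x
  proof -
    have "(a + b) * ((1 - t) * (f x / a)) = f x" "(a + b) * (t * (g x / b)) = g x"
      unfolding t(3) using ab by (simp_all add: t_def)
    then have "f x + g x = (a + b) * ((1 - t) * (f x / a) + t * (g x / b))"
      by (simp add: distrib_left)
    then have "\<bar>f x + g x\<bar> powr p = (a + b) powr p * \<bar>(1 - t) * (f x / a) + t * (g x / b)\<bar> powr p"
      using ab by (simp add: abs_mult powr_mult)
    also have "\<dots> \<le> (a + b) powr p * ((1 - t) * \<bar>f x / a\<bar> powr p + t * \<bar>g x / b\<bar> powr p)"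
      using convex_onD[OF convex_on_abs_powr[OF p] t(1,2), of "f x / a" "g x / b"]
      by (intro mult_left_mono) auto
    finally show ?thesis using ab by (simp add: abs_divide powr_divide)
  qed
  have fa: "(\<integral>x. \<bar>f x\<bar> powr p \<partial>M) \<le> a powr p" and gb: "(\<integral>x. \<bar>g x\<bar> powr p \<partial>M) \<le> b powr p"
    using \<open>e > 0\<close> p ab by (subst Lp_norm_le_iff[symmetric]; simp add: a_def b_def)+
  have "(\<integral>x. \<bar>f x + g x\<bar> powr p \<partial>M) \<le>
      (\<integral>x. (a + b) powr p * ((1 - t) * (\<bar>f x\<bar> powr p / a powr p) + t * (\<bar>g x\<bar> powr p / b powr p)) \<partial>M)"
  proof (rule integral_mono'[OF _ pointwise])
    show "0 \<le> (a + b) powr p * ((1 - t) * (\<bar>f x\<bar> powr p / a powr p) + t * (\<bar>g x\<bar> powr p / b powr p))" for x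
      using t(1,2) by (intro mult_nonneg_nonneg add_nonneg_nonneg) auto
  qed (use int in auto)
  also have "\<dots> = (a + b) powr p * ((1 - t) * ((\<integral>x. \<bar>f x\<bar> powr p \<partial>M) / a powr p)
      + t * ((\<integral>x. \<bar>g x\<bar> powr p \<partial>M) / b powr p))"
    using int by simp
  also have "\<dots> \<le> (a + b) powr p * ((1 - t) * 1 + t * 1)"
    using t ab fa gb by (intro mult_left_mono add_mono) auto
  finally have "Lp_norm p M (\<lambda>x. f x + g x) \<le> a + b"
    using p ab by (subst Lp_norm_le_iff) auto
  then show "Lp_norm p M (\<lambda>x. f x + g x) \<le> Lp_norm p M f + Lp_norm p M g + e"
    by (simp add: a_def b_def)
qed

lemma Lp_norm_sum_le:
  fixes C :: "'b \<Rightarrow> real"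
  assumes p: "1 \<le> p" and "finite I"
    and f: "\<And>i. i \<in> I \<Longrightarrow> f i \<in> borel_measurable M"
      "\<And>i x. i \<in> I \<Longrightarrow> x \<in> space M \<Longrightarrow> \<bar>f i x\<bar> \<le> C i"
  shows "Lp_norm p M (\<lambda>x. \<Sum>i\<in>I. f i x) \<le> (\<Sum>i\<in>I. Lp_norm p M (f i))"
  using \<open>finite I\<close> f
proof (induction I)
  case empty
  then show ?case by (simp add: Lp_norm_def)
next
  case (insert j I)
  have "Lp_norm p M (\<lambda>x. f j x + (\<Sum>i\<in>I. f i x)) \<le> Lp_norm p M (f j) + Lp_norm p M (\<lambda>x. \<Sum>i\<in>I. f i x)"
  proof (rule Lp_norm_add_le[OF p])
    show "\<bar>\<Sum>i\<in>I. f i x\<bar> \<le> (\<Sum>i\<in>I. C i)" if "x \<in> space M" for x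
      using insert.prems that by (intro order_trans[OF sum_abs] sum_mono) auto
  qed (use insert.prems in auto)
  also have "\<dots> \<le> Lp_norm p M (f j) + (\<Sum>i\<in>I. Lp_norm p M (f i))"
    using insert by (intro add_left_mono insert.IH) auto
  finally show ?case using insert by simp
qed

end

context prob_space
begin

lemma Lp_norm_const: "p > 0 \<Longrightarrow> Lp_norm p M (\<lambda>x. a) = \<bar>a\<bar>"
  by (simp add: Lp_norm_def prob_space powr_powr_inverse)

text \<open>Under a probability measure a constant has norm equal to its absolute value. This is how
  uniform estimates coming from an RKHS norm are added to genuine \<open>Lp_norm\<close>
  estimates.\<close>

lemma Lp_norm_le_of_abs_le_const_add:
  fixes a C :: real
  assumes p: "1 \<le> p" and u: "u \<in> borel_measurable M" "\<And>x. x \<in> space M \<Longrightarrow> \<bar>u x\<bar> \<le> C"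
    and f: "\<And>x. x \<in> space M \<Longrightarrow> \<bar>f x\<bar> \<le> a + \<bar>u x\<bar>"
  shows "Lp_norm p M f \<le> \<bar>a\<bar> + Lp_norm p M u"
proof -
  have "Lp_norm p M f \<le> Lp_norm p M (\<lambda>x. a + \<bar>u x\<bar>)"
  proof (rule Lp_norm_mono)
    show "\<bar>a + \<bar>u x\<bar>\<bar> \<le> \<bar>a\<bar> + C" if "x \<in> space M" for x using u(2)[OF that] by linarith
    show "\<bar>f x\<bar> \<le> \<bar>a + \<bar>u x\<bar>\<bar>" if "x \<in> space M" for x using f[OF that] by linarith
  qed (use p u in auto)
  also have "\<dots> \<le> Lp_norm p M (\<lambda>x. a) + Lp_norm p M (\<lambda>x. \<bar>u x\<bar>)"
    using p u by (intro Lp_norm_add_le[where C = "\<bar>a\<bar>" and D = C]) auto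
  also have "\<dots> = \<bar>a\<bar> + Lp_norm p M u"
    using p by (simp add: Lp_norm_const) (simp add: Lp_norm_def)
  finally show ?thesis .
qed

lemma abs_expectation_powr_le:
  fixes C :: real
  assumes p: "1 \<le> p" and f: "f \<in> borel_measurable M" "\<And>x. x \<in> space M \<Longrightarrow> \<bar>f x\<bar> \<le> C"
  shows "\<bar>expectation f\<bar> powr p \<le> expectation (\<lambda>x. \<bar>f x\<bar> powr p)"
  using f p by (intro jensens_inequality[where I = UNIV] integrable_abs_powr convex_on_abs_powr
      integrable_const_bound[where B = C] AE_I2) auto

lemma expectation_abs_le_Lp_norm:
  fixes C :: real
  assumes p: "1 \<le> p" and f: "f \<in> borel_measurable M" "\<And>x. x \<in> space M \<Longrightarrow> \<bar>f x\<bar> \<le> C"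
  shows "expectation (\<lambda>x. \<bar>f x\<bar>) \<le> Lp_norm p M f"
proof -
  have "\<bar>expectation (\<lambda>x. \<bar>f x\<bar>)\<bar> powr p \<le> expectation (\<lambda>x. \<bar>f x\<bar> powr p)"
    using abs_expectation_powr_le[OF p, of "\<lambda>x. \<bar>f x\<bar>" C] f by simp
  then have "(\<bar>expectation (\<lambda>x. \<bar>f x\<bar>)\<bar> powr p) powr (1 / p) \<le> Lp_norm p M f"
    unfolding Lp_norm_def using p by (intro powr_mono2) auto
  then show ?thesis using p by (simp add: powr_powr)
qed

text \<open>Jensen's inequality in the inner variable, then Fubini. It turns the average of the
  kernel difference over one argument into its norm under the product measure.\<close>

lemma Lp_norm_expectation_le:
  fixes C :: real
  assumes p: "1 \<le> p" and f: "case_prod f \<in> borel_measurable (M \<Otimes>\<^sub>M M)"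
    "\<And>x y. x \<in> space M \<Longrightarrow> y \<in> space M \<Longrightarrow> \<bar>f x y\<bar> \<le> C"
  shows "Lp_norm p M (\<lambda>x. expectation (f x)) \<le> Lp_norm p (M \<Otimes>\<^sub>M M) (\<lambda>(x, y). f x y)"
proof -
  interpret MM: pair_prob_space M M ..
  note [measurable] = f(1)
  have int: "integrable (M \<Otimes>\<^sub>M M) (\<lambda>z. \<bar>case_prod f z\<bar> powr p)"
    using p f by (intro MM.P.integrable_abs_powr[where C = C]) (auto simp: space_pair_measure)
  have "expectation (\<lambda>x. \<bar>expectation (f x)\<bar> powr p) \<le> expectation (\<lambda>x. expectation (\<lambda>y. \<bar>f x y\<bar> powr p))"
    using MM.integrable_fst'[OF int] p f
    by (intro integral_mono' abs_expectation_powr_le[where C = C]) auto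
  also have "\<dots> = (\<integral>z. \<bar>case_prod f z\<bar> powr p \<partial>(M \<Otimes>\<^sub>M M))"
    using MM.integral_fst'[OF int] by simp
  finally show ?thesis using p by (simp add: Lp_norm_def powr_mono2)
qed

end

section \<open>Total variation and differences of integrals\<close>

lemma integral_indicator_mono_measure:
  fixes v :: "'a \<Rightarrow> real"
  assumes fin: "finite_measure M" "finite_measure N" and sets: "sets N = sets M" and A: "A \<in> sets M"
    and le: "\<And>X. X \<in> sets M \<Longrightarrow> X \<subseteq> A \<Longrightarrow> emeasure N X \<le> emeasure M X"
    and v: "v \<in> borel_measurable M" "\<And>x. x \<in> space M \<Longrightarrow> 0 \<le> v x" "\<And>x. x \<in> space M \<Longrightarrow> v x \<le> C"
  shows "(\<integral>x. indicator A x * v x \<partial>N) \<le> (\<integral>x. indicator A x * v x \<partial>M)"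
proof -
  interpret M: finite_measure M by fact
  note sp = sets_eq_imp_space_eq[OF sets]
  have v': "v \<in> borel_measurable N" using v(1) measurable_cong_sets[OF sets] by blast
  have A': "A \<in> sets N" using A sets by simp
  \<comment> \<open>Cutting both measures down to \<open>A\<close> turns the inequality on subsets
    of \<open>A\<close> into an order of measures, in which nonnegative integrals are
    monotone.\<close>
  have "density N (indicator A) \<le> density M (indicator A)"
    using A A' sets by (subst le_measure) (auto simp: emeasure_restricted intro!: le)
  then have "(\<integral>\<^sup>+x. v x \<partial>density N (indicator A)) \<le> (\<integral>\<^sup>+x. v x \<partial>density M (indicator A))"
    using sets by (intro nn_integral_mono_measure) simp_all
  then have nn: "(\<integral>\<^sup>+x. indicator A x * ennreal (v x) \<partial>N) \<le> (\<integral>\<^sup>+x. indicator A x * ennreal (v x) \<partial>M)"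
    using A A' v(1) v' by (simp add: nn_integral_density)
  have eq: "indicator A x * ennreal (v x) = ennreal (indicator A x * v x)" for x
    by (simp add: indicator_def)
  have int: "integrable M (\<lambda>x. indicator A x * v x)"
  proof (rule M.integrable_const_bound[where B = "\<bar>C\<bar>"], rule AE_I2)
    show "norm (indicator A x * v x) \<le> \<bar>C\<bar>" if "x \<in> space M" for x
      using v(2,3)[OF that] by (auto simp: indicator_def)
  qed (use A v(1) in simp)
  have "(\<integral>\<^sup>+x. indicator A x * ennreal (v x) \<partial>M) < \<infinity>"
    unfolding eq using int v(2) by (subst nn_integral_eq_integral) (auto simp: less_top)
  moreover have "(\<integral>x. indicator A x * v x \<partial>N) = enn2real (\<integral>\<^sup>+x. indicator A x * ennreal (v x) \<partial>N)"
    unfolding eq using A' v' v(2) sp by (intro integral_eq_nn_integral) auto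
  moreover have "(\<integral>x. indicator A x * v x \<partial>M) = enn2real (\<integral>\<^sup>+x. indicator A x * ennreal (v x) \<partial>M)"
    unfolding eq using A v by (intro integral_eq_nn_integral) auto
  ultimately show ?thesis using nn by (simp add: enn2real_mono)
qed

text \<open>A real \<open>Sup\<close> bounds its elements only if the set is bounded above; here the
  sum of the two total masses bounds every partition sum.\<close>

lemma sum_abs_diff_le_tv_norm:
  assumes fin: "finite_measure M" "finite_measure N" and sets: "sets N = sets M"
    and E: "finite \<E>" "\<E> \<subseteq> sets M" "partition_on (space M) \<E>"
  shows "(\<Sum>E\<in>\<E>. \<bar>measure M E - measure N E\<bar>) \<le> tv_norm M (\<lambda>E. measure M E - measure N E)"
  unfolding tv_norm_def
proof (rule cSup_upper)
  interpret M: finite_measure M by fact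
  interpret N: finite_measure N by fact
  show "bdd_above {\<Sum>E\<in>\<E>. \<bar>measure M E - measure N E\<bar> |\<E>.
      finite \<E> \<and> \<E> \<subseteq> sets M \<and> partition_on (space M) \<E>}"
  proof (rule bdd_aboveI[where M = "measure M (space M) + measure N (space M)"], safe)
    fix \<E> assume \<E>: "finite \<E>" "\<E> \<subseteq> sets M" "partition_on (space M) \<E>"
    have disj: "disjoint_family_on (\<lambda>E. E) \<E>"
      using partition_onD2[OF \<E>(3)] by (auto simp: disjoint_family_on_def disjoint_def)
    have "(\<Sum>E\<in>\<E>. \<bar>measure M E - measure N E\<bar>) \<le> (\<Sum>E\<in>\<E>. measure M E) + (\<Sum>E\<in>\<E>. measure N E)"
      unfolding sum.distrib[symmetric] by (intro sum_mono abs_leI) auto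
    also have "(\<Sum>E\<in>\<E>. measure M E) = measure M (\<Union>E\<in>\<E>. E)"
      using \<E> disj by (intro M.finite_measure_finite_Union[symmetric]) auto
    also have "(\<Sum>E\<in>\<E>. measure N E) = measure N (\<Union>E\<in>\<E>. E)"
      using \<E> disj sets by (intro N.finite_measure_finite_Union[symmetric]) auto
    finally show "(\<Sum>E\<in>\<E>. \<bar>measure M E - measure N E\<bar>) \<le> measure M (space M) + measure N (space M)"
      using partition_onD1[OF \<E>(3)] by simp
  qed
qed (use E in blast)

lemma tv_norm_nonneg:
  assumes fin: "finite_measure M" "finite_measure N" and sets: "sets N = sets M"
  shows "0 \<le> tv_norm M (\<lambda>E. measure M E - measure N E)"
proof -
  \<comment> \<open>\<open>partition_on\<close> forbids empty blocks, so an empty space has to be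
    partitioned by the empty family.\<close>
  have "0 \<le> (\<Sum>E\<in>{space M} - {{}}. \<bar>measure M E - measure N E\<bar>)" by (rule sum_nonneg) simp
  also have "\<dots> \<le> tv_norm M (\<lambda>E. measure M E - measure N E)"
    by (intro sum_abs_diff_le_tv_norm assms) (auto simp: partition_on_def disjoint_def)
  finally show ?thesis .
qed

text \<open>On the Hahn set \<open>A\<close>, where the first measure dominates, \<open>u\<close> is
  replaced by \<open>C\<close>; on the complement \<open>B\<close> it is replaced by
  \<open>- C\<close>. The nonnegative functions \<open>C - u\<close> and \<open>C + u\<close> make
  both replacements instances of monotonicity in the measure. The blocks \<open>A\<close> and
  \<open>B\<close> then form one of the partitions in \<open>tv_norm\<close>, so no factor 2
  appears.\<close>

lemma integral_diff_le_tv_norm: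
  fixes u :: "'a \<Rightarrow> real"
  assumes fin: "finite_measure M" "finite_measure N" and sets: "sets N = sets M" and "0 \<le> C"
    and u: "u \<in> borel_measurable M" "\<And>x. x \<in> space M \<Longrightarrow> \<bar>u x\<bar> \<le> C"
  shows "(\<integral>x. u x \<partial>M) - (\<integral>x. u x \<partial>N) \<le> C * tv_norm M (\<lambda>E. measure M E - measure N E)"
proof -
  interpret M: finite_measure M by fact
  interpret N: finite_measure N by fact
  note sp = sets_eq_imp_space_eq[OF sets]
  obtain A where A: "A \<in> sets M" and hahn: "(\<forall>X\<in>sets M. X \<subseteq> A \<longrightarrow> emeasure N X \<le> emeasure M X) \<and>
      (\<forall>X\<in>sets M. X \<inter> A = {} \<longrightarrow> emeasure M X \<le> emeasure N X)"
    using finite_unsigned_Hahn_decomposition[OF fin sets] by (rule bexE)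
  have A1: "emeasure N X \<le> emeasure M X" if "X \<in> sets M" "X \<subseteq> A" for X using hahn that by simp
  have A2: "emeasure M X \<le> emeasure N X" if "X \<in> sets M" "X \<inter> A = {}" for X using hahn that by simp
  define B where "B = space M - A"
  have B: "B \<in> sets M" using A by (simp add: B_def)
  have u': "u \<in> borel_measurable N" using u(1) measurable_cong_sets[OF sets] by blast
  have AB': "A \<in> sets N" "B \<in> sets N" using A B sets by auto
  have intM: "integrable M u"
    using u by (intro M.integrable_const_bound[where B = C] AE_I2) simp_all
  have intN: "integrable N u"
    using u' u(2) sp by (intro N.integrable_const_bound[where B = C] AE_I2) simp_all
  have i1: "(\<integral>x. indicator A x * (C - u x) \<partial>N) \<le> (\<integral>x. indicator A x * (C - u x) \<partial>M)"
  proof (rule integral_indicator_mono_measure[OF fin sets A A1])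
    show "0 \<le> C - u x" "C - u x \<le> 2 * C" if "x \<in> space M" for x using u(2)[OF that] by auto
  qed (use u(1) in auto)
  have i2: "(\<integral>x. indicator B x * (C + u x) \<partial>M) \<le> (\<integral>x. indicator B x * (C + u x) \<partial>N)"
  proof (rule integral_indicator_mono_measure[OF fin(2,1)])
    show "emeasure M X \<le> emeasure N X" if "X \<in> sets N" "X \<subseteq> B" for X
      using that by (intro A2) (auto simp: B_def sets)
    show "0 \<le> C + u x" "C + u x \<le> 2 * C" if "x \<in> space N" for x using u(2)[of x] that sp by auto
  qed (use u' AB' sets in auto)
  have iA: "(\<integral>x. indicator A x * (C - u x) \<partial>K) = C * measure K A - (\<integral>x. indicator A x * u x \<partial>K)"
    and iB: "(\<integral>x. indicator B x * (C + u x) \<partial>K) = C * measure K B + (\<integral>x. indicator B x * u x \<partial>K)"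
    and iAB: "(\<integral>x. u x \<partial>K) = (\<integral>x. indicator A x * u x \<partial>K) + (\<integral>x. indicator B x * u x \<partial>K)"
    if "finite_measure K" "integrable K u" "A \<in> sets K" "B \<in> sets K" "space K = space M" for K
  proof -
    interpret K: finite_measure K by fact
    have A': "A \<inter> space M = A" "B \<inter> space M = B" using A B by simp_all
    have ii: "integrable K (\<lambda>x. indicator A x * u x)" "integrable K (\<lambda>x. indicator B x * u x)"
      using integrable_mult_indicator[OF that(3,2)] integrable_mult_indicator[OF that(4,2)] by simp_all
    have ic: "integrable K (\<lambda>x. C * indicator A x)" "integrable K (\<lambda>x. C * indicator B x)"
      using that by (auto intro!: integrable_mult_right simp: less_top K.emeasure_eq_measure)
    have "(\<integral>x. indicator A x * (C - u x) \<partial>K) = (\<integral>x. C * indicator A x - indicator A x * u x \<partial>K)"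
      by (simp add: algebra_simps)
    then show "(\<integral>x. indicator A x * (C - u x) \<partial>K) = C * measure K A - (\<integral>x. indicator A x * u x \<partial>K)"
      using ii ic that A' by simp
    have "(\<integral>x. indicator B x * (C + u x) \<partial>K) = (\<integral>x. C * indicator B x + indicator B x * u x \<partial>K)"
      by (simp add: algebra_simps)
    then show "(\<integral>x. indicator B x * (C + u x) \<partial>K) = C * measure K B + (\<integral>x. indicator B x * u x \<partial>K)"
      using ii ic that A' by simp
    have "(\<integral>x. u x \<partial>K) = (\<integral>x. indicator A x * u x + indicator B x * u x \<partial>K)"
      by (intro Bochner_Integration.integral_cong) (auto simp: B_def indicator_def that)
    then show "(\<integral>x. u x \<partial>K) = (\<integral>x. indicator A x * u x \<partial>K) + (\<integral>x. indicator B x * u x \<partial>K)"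
      using ii by simp
  qed
  note KM = fin(1) intM A B refl and KN = fin(2) intN AB' sp
  let ?\<nu> = "\<lambda>E. measure M E - measure N E"
  have "(\<integral>x. u x \<partial>M) - (\<integral>x. u x \<partial>N) \<le> C * (measure M A - measure N A) + C * (measure N B - measure M B)"
    using i1 i2 unfolding iA[OF KM] iA[OF KN] iB[OF KM] iB[OF KN] iAB[OF KM] iAB[OF KN]
    by (simp add: algebra_simps)
  also have "\<dots> \<le> C * (\<bar>?\<nu> A\<bar> + \<bar>?\<nu> B\<bar>)"
    using \<open>0 \<le> C\<close> unfolding distrib_left[symmetric] by (intro mult_left_mono) auto
  \<comment> \<open>The set \<open>{A, B}\<close> collapses if both blocks are empty, and a single
    empty block is no member of a partition; an empty block contributes 0 in either case.\<close>
  also have "\<bar>?\<nu> A\<bar> + \<bar>?\<nu> B\<bar> = (\<Sum>E\<in>{A, B}. \<bar>?\<nu> E\<bar>)"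
  proof (cases "A = B")
    case True
    then have "A = {}" "B = {}" by (auto simp: B_def)
    then show ?thesis by simp
  qed simp
  also have "\<dots> = (\<Sum>E\<in>{A, B} - {{}}. \<bar>?\<nu> E\<bar>)"
    by (rule sum.mono_neutral_right) auto
  also have "\<dots> \<le> tv_norm M ?\<nu>"
    using A B sets.sets_into_space[OF A]
    by (intro sum_abs_diff_le_tv_norm fin sets) (auto simp: partition_on_def disjoint_def B_def)
  finally show ?thesis using \<open>0 \<le> C\<close> by (simp add: mult_left_mono)
qed


section \<open>Smoothing convex functions\<close>

lemma convex_on_of_subgradient:
  fixes u h :: "real \<Rightarrow> real"
  assumes "\<And>t s. u t + h t * (s - t) \<le> u s"
  shows "convex_on UNIV u"
proof (intro convex_onI)
  fix a x y :: real assume a: "0 < a" "a < 1"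
  define z where "z = (1 - a) * x + a * y"
  have "(1 - a) * (u z + h z * (x - z)) + a * (u z + h z * (y - z)) \<le> (1 - a) * u x + a * u y"
    using a assms by (intro add_mono mult_left_mono) auto
  moreover have "(1 - a) * (u z + h z * (x - z)) + a * (u z + h z * (y - z)) = u z"
    by (simp add: z_def algebra_simps)
  ultimately show "u ((1 - a) *\<^sub>R x + a *\<^sub>R y) \<le> (1 - a) * u x + a * u y"
    by (simp add: z_def)
qed auto

text \<open>Averaging a convex function over \<^term>\<open>{t..t + \<epsilon>}\<close> yields a function with the explicit
  Lipschitz continuous derivative \<^term>\<open>(u (t + \<epsilon>) - u t) / \<epsilon>\<close>; no measurable selection of
  subgradients is needed.\<close>

definition smoothing :: "real \<Rightarrow> (real \<Rightarrow> real) \<Rightarrow> real \<Rightarrow> real" where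
  "smoothing \<epsilon> u t = (\<integral>s. (u (t + \<epsilon> * s) - u (\<epsilon> * s)) * indicator {0..1} s \<partial>lborel)"

definition smoothing_deriv :: "real \<Rightarrow> (real \<Rightarrow> real) \<Rightarrow> real \<Rightarrow> real" where
  "smoothing_deriv \<epsilon> u t = (u (t + \<epsilon>) - u t) / \<epsilon>"

text \<open>The subtracted \<open>u (\<epsilon> * s)\<close> in the integrand is there for this
  normalization, which the locale \<open>lipschitz_convex_loss\<close> demands as
  \<open>loss_zero\<close>.\<close>

lemma smoothing_zero: "smoothing \<epsilon> u 0 = 0"
  by (simp add: smoothing_def)

text \<open>The inner points \<open>t + \<epsilon>\<close> and \<open>s\<close> are convex
  combinations of \<open>t\<close> and \<open>s + \<epsilon>\<close> with interchanged weights, so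
  the two convexity inequalities add up to the claim.\<close>

lemma convex_increment_mono:
  fixes u :: "real \<Rightarrow> real"
  assumes u: "convex_on UNIV u" and "\<epsilon> > 0" "t \<le> s"
  shows "u (t + \<epsilon>) - u t \<le> u (s + \<epsilon>) - u s"
proof -
  define a where "a = \<epsilon> / (s - t + \<epsilon>)"
  have a: "0 \<le> a" "a \<le> 1" and a': "a * (s - t + \<epsilon>) = \<epsilon>"
    using assms by (auto simp: a_def)
  have "(1 - a) * t + a * (s + \<epsilon>) = t + a * (s - t + \<epsilon>)"
    by (simp add: algebra_simps)
  then have e1: "(1 - a) * t + a * (s + \<epsilon>) = t + \<epsilon>" by (simp add: a')
  have "(1 - (1 - a)) * t + (1 - a) * (s + \<epsilon>) = s + \<epsilon> - a * (s - t + \<epsilon>)"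
    by (simp add: algebra_simps)
  then have e2: "(1 - (1 - a)) * t + (1 - a) * (s + \<epsilon>) = s" by (simp add: a')
  have "u (t + \<epsilon>) \<le> (1 - a) * u t + a * u (s + \<epsilon>)"
    using convex_onD[OF u a, of t "s + \<epsilon>"] e1 by simp
  moreover have "u s \<le> (1 - (1 - a)) * u t + (1 - a) * u (s + \<epsilon>)"
    using convex_onD[OF u _ _, of "1 - a" t "s + \<epsilon>"] a e2 by simp
  ultimately show ?thesis by (simp add: algebra_simps)
qed

locale lipschitz_convex =
  fixes u :: "real \<Rightarrow> real" and c \<epsilon> :: real
  assumes lipschitz: "\<And>s t. \<bar>u s - u t\<bar> \<le> c * \<bar>s - t\<bar>"
    and convex: "convex_on UNIV u"
    and eps: "\<epsilon> > 0"
begin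

lemma const_nonneg: "0 \<le> c"
  using lipschitz[of 1 0] by simp

lemma continuous: "isCont u t"
proof -
  have "c-lipschitz_on UNIV u"
    using lipschitz const_nonneg by (auto intro!: lipschitz_onI simp: dist_real_def)
  then show ?thesis
    using lipschitz_on_continuous_on continuous_on_eq_continuous_at by blast
qed

lemma continuous_on_shift [continuous_intros]:
  "continuous_on A g \<Longrightarrow> continuous_on A (\<lambda>s. u (g s))"
  by (rule continuous_on_compose2[of UNIV u]) (auto intro: continuous_at_imp_continuous_on continuous)

lemma integrable_Icc:
  fixes g :: "real \<Rightarrow> real"
  assumes "continuous_on {0..1} g"
  shows "integrable lborel (\<lambda>s. g s * indicator {0..1} s)"
  using borel_integrable_atLeastAtMost'[of 0 1 g] assms
  by (simp add: set_integrable_def mult.commute)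

lemma abs_integral_Icc_le:
  fixes g :: "real \<Rightarrow> real" and C :: real
  assumes "continuous_on {0..1} g" "\<And>s. 0 \<le> s \<Longrightarrow> s \<le> 1 \<Longrightarrow> \<bar>g s\<bar> \<le> C"
  shows "\<bar>\<integral>s. g s * indicator {0..1} s \<partial>lborel\<bar> \<le> C"
proof -
  have "\<bar>\<integral>s. g s * indicator {0..1} s \<partial>lborel\<bar> \<le> (\<integral>s. \<bar>g s * indicator {0..1} s\<bar> \<partial>lborel)"
    using integral_norm_bound[of lborel "\<lambda>s. g s * indicator {0..1} s"] by simp
  also have "\<dots> \<le> (\<integral>s. C * indicator {0..1::real} s \<partial>lborel)"
  proof (rule Bochner_Integration.integral_mono)
    show "integrable lborel (\<lambda>s. \<bar>g s * indicator {0..1} s\<bar>)"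
      by (intro integrable_abs integrable_Icc assms(1))
    show "\<bar>g s * indicator {0..1} s\<bar> \<le> C * indicator {0..1} s" for s
      using assms(2) by (simp add: indicator_def)
  qed simp
  finally show ?thesis by simp
qed

lemma smoothing_lipschitz: "\<bar>smoothing \<epsilon> u s - smoothing \<epsilon> u t\<bar> \<le> c * \<bar>s - t\<bar>"
proof -
  have "smoothing \<epsilon> u s - smoothing \<epsilon> u t =
      (\<integral>r. (u (s + \<epsilon> * r) - u (t + \<epsilon> * r)) * indicator {0..1} r \<partial>lborel)"
    unfolding smoothing_def
    by (subst Bochner_Integration.integral_diff[symmetric])
      (auto intro!: integrable_Icc continuous_intros Bochner_Integration.integral_cong simp: left_diff_distrib)
  moreover have "\<bar>\<dots>\<bar> \<le> c * \<bar>s - t\<bar>"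
  proof (intro abs_integral_Icc_le continuous_intros)
    show "\<bar>u (s + \<epsilon> * r) - u (t + \<epsilon> * r)\<bar> \<le> c * \<bar>s - t\<bar>" for r
      using lipschitz[of "s + \<epsilon> * r" "t + \<epsilon> * r"] by simp
  qed
  ultimately show ?thesis by simp
qed

text \<open>Both arguments, \<open>t\<close> and 0, are shifted by at most
  \<open>\<epsilon>\<close>, and each shift costs \<open>c * \<epsilon>\<close>.\<close>

lemma smoothing_close: "\<bar>smoothing \<epsilon> u t - (u t - u 0)\<bar> \<le> 2 * c * \<epsilon>"
proof -
  have "smoothing \<epsilon> u t - (\<integral>r. (u t - u 0) * indicator {0..1::real} r \<partial>lborel) =
      (\<integral>r. (u (t + \<epsilon> * r) - u (\<epsilon> * r) - (u t - u 0)) * indicator {0..1} r \<partial>lborel)"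
    unfolding smoothing_def
    by (subst Bochner_Integration.integral_diff[symmetric])
      (auto intro!: integrable_Icc continuous_intros Bochner_Integration.integral_cong simp: left_diff_distrib)
  moreover have "\<bar>\<dots>\<bar> \<le> 2 * c * \<epsilon>"
  proof (intro abs_integral_Icc_le continuous_intros)
    fix r :: real assume r: "0 \<le> r" "r \<le> 1"
    have "c * \<bar>\<epsilon> * r\<bar> \<le> c * \<epsilon>"
      using r eps const_nonneg by (intro mult_left_mono) (auto simp: abs_mult mult_left_le)
    then show "\<bar>u (t + \<epsilon> * r) - u (\<epsilon> * r) - (u t - u 0)\<bar> \<le> 2 * c * \<epsilon>"
      using lipschitz[of "t + \<epsilon> * r" t] lipschitz[of "\<epsilon> * r" 0] by simp
  qed
  ultimately show ?thesis by simp
qed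

lemma smoothing_deriv_abs_le: "\<bar>smoothing_deriv \<epsilon> u t\<bar> \<le> c"
  using lipschitz[of "t + \<epsilon>" t] eps by (simp add: smoothing_deriv_def field_simps)

text \<open>The constant blows up as \<open>\<epsilon>\<close> tends to 0. This is harmless, since
  it enters only the quadratic remainder of \<open>smoothing_expansion\<close>, which the
  first-order condition discards.\<close>

lemma smoothing_deriv_lipschitz:
  "\<bar>smoothing_deriv \<epsilon> u s - smoothing_deriv \<epsilon> u t\<bar> \<le> 2 * c / \<epsilon> * \<bar>s - t\<bar>"
proof -
  have "\<bar>(u (s + \<epsilon>) - u (t + \<epsilon>)) - (u s - u t)\<bar> \<le> 2 * c * \<bar>s - t\<bar>"
    using lipschitz[of "s + \<epsilon>" "t + \<epsilon>"] lipschitz[of s t] by simp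
  moreover have "smoothing_deriv \<epsilon> u s - smoothing_deriv \<epsilon> u t
      = ((u (s + \<epsilon>) - u (t + \<epsilon>)) - (u s - u t)) / \<epsilon>"
    by (simp add: smoothing_deriv_def diff_divide_distrib)
  ultimately show ?thesis
    using eps by (simp add: abs_divide divide_right_mono)
qed

text \<open>With an antiderivative \<open>F\<close> of \<open>u\<close>, the average is the
  difference quotient \<open>G\<close> of \<open>F\<close> up to a constant. Its derivative
  \<open>smoothing_deriv\<close> is nondecreasing because \<open>u\<close> is convex, and the mean
  value theorem gives the inequality on either side of \<open>t\<close>.\<close>

lemma smoothing_subgradient:
  "smoothing \<epsilon> u t + smoothing_deriv \<epsilon> u t * (s - t) \<le> smoothing \<epsilon> u s"
proof -
  have "\<exists>F. \<forall>x::real. -\<infinity> < ereal x \<longrightarrow> ereal x < \<infinity> \<longrightarrow> (F has_vector_derivative u x) (at x)"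
    by (rule einterval_antiderivative) (auto intro: continuous)
  then obtain F where F: "\<And>x. (F has_real_derivative u x) (at x)"
    by (auto simp: has_real_derivative_iff_has_vector_derivative)
  have F': "((\<lambda>s. F (g s)) has_real_derivative u (g x) * d) (at x)"
    if "(g has_real_derivative d) (at x)" for g d x
    using DERIV_chain2[OF F that] .
  define K where "K = (F \<epsilon> - F 0) / \<epsilon>"
  define G where "G r = (F (r + \<epsilon>) - F r) / \<epsilon>" for r
  have eq: "smoothing \<epsilon> u r = G r - K" for r
  proof -
    have "(\<integral>x. (u (r + \<epsilon> * x) - u (\<epsilon> * x)) * indicator {0..1} x \<partial>lborel) =
       (F (r + \<epsilon> * 1) / \<epsilon> - F (\<epsilon> * 1) / \<epsilon>) - (F (r + \<epsilon> * 0) / \<epsilon> - F (\<epsilon> * 0) / \<epsilon>)"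
      using eps by (intro integral_FTC_Icc_real)
        (auto intro!: derivative_eq_intros F' continuous_intros isCont_o2[OF _ continuous])
    then show ?thesis by (simp add: smoothing_def G_def K_def diff_divide_distrib)
  qed
  have G: "(G has_real_derivative smoothing_deriv \<epsilon> u r) (at r)" for r
    unfolding G_def smoothing_deriv_def using eps by (auto intro!: derivative_eq_intros F')
  have mono: "smoothing_deriv \<epsilon> u x \<le> smoothing_deriv \<epsilon> u y" if "x \<le> y" for x y
    using convex_increment_mono[OF convex eps that] eps by (simp add: smoothing_deriv_def divide_right_mono)
  have "G t + smoothing_deriv \<epsilon> u t * (s - t) \<le> G s"
  proof (cases t s rule: linorder_cases)
    case less
    then obtain z where "t < z" "z < s" "G s - G t = (s - t) * smoothing_deriv \<epsilon> u z"
      using MVT2[OF less, of G "smoothing_deriv \<epsilon> u"] G by blast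
    moreover from this have "(s - t) * smoothing_deriv \<epsilon> u t \<le> (s - t) * smoothing_deriv \<epsilon> u z"
      using mono[of t z] less by (intro mult_left_mono) auto
    ultimately show ?thesis by (simp add: algebra_simps)
  next
    case greater
    then obtain z where "s < z" "z < t" "G t - G s = (t - s) * smoothing_deriv \<epsilon> u z"
      using MVT2[OF greater, of G "smoothing_deriv \<epsilon> u"] G by blast
    moreover from this have "(t - s) * smoothing_deriv \<epsilon> u z \<le> (t - s) * smoothing_deriv \<epsilon> u t"
      using mono[of z t] greater by (intro mult_left_mono) auto
    ultimately show ?thesis by (simp add: algebra_simps)
  qed simp
  then show ?thesis by (simp add: eq)
qed

lemma smoothing_convex: "convex_on UNIV (smoothing \<epsilon> u)"
  by (rule convex_on_of_subgradient[OF smoothing_subgradient])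

end

lemma borel_measurable_smoothing:
  assumes "(\<lambda>(z, t). l z t) \<in> borel_measurable (M \<Otimes>\<^sub>M borel)"
  shows "(\<lambda>(z, t). smoothing \<epsilon> (l z) t) \<in> borel_measurable (M \<Otimes>\<^sub>M borel)"
proof -
  have [measurable]: "(\<lambda>x. l (f x) (g x)) \<in> borel_measurable N"
    if [measurable]: "f \<in> measurable N M" "g \<in> borel_measurable N" for f g N
    using measurable_compose[OF measurable_Pair[OF that] assms] by simp
  show ?thesis
    unfolding smoothing_def case_prod_beta
    by (intro lborel.borel_measurable_lebesgue_integral) (simp add: case_prod_beta)
qed


section \<open>Support vector machines\<close>

text \<open>\<open>N\<close> serves only to carry a sigma-algebra on \<open>S\<close>. The number
  \<open>\<kappa>\<close> is any bound for the kernel, so that two kernels can share the larger of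
  their norms.\<close>

locale bounded_kernel_rkhs = rkhs S k H ip
  for S :: "'a set" and k H ip +
  fixes N :: "'a measure" and \<kappa> :: real
  assumes space_N: "space N = S"
    and measurable_kernel: "case_prod k \<in> borel_measurable (N \<Otimes>\<^sub>M N)"
    and kernel_le: "\<And>x. x \<in> S \<Longrightarrow> sqrt (k x x) \<le> \<kappa>"
    and kappa_nonneg: "0 \<le> \<kappa>"
begin

lemma kernel_commute:
  assumes "x \<in> S" "y \<in> S" shows "k x y = k y x"
  using reproducing[OF section_mem[OF assms(2)] assms(1)] reproducing[OF section_mem[OF assms(1)] assms(2)]
    ip_commute[OF section_mem[OF assms(2)] section_mem[OF assms(1)]] assms
  by (simp add: zero_ext_def)

lemma section_measurable:
  assumes "x \<in> S" shows "zero_ext S (\<lambda>y. k y x) \<in> borel_measurable N"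
proof -
  have "(\<lambda>y. k y x) \<in> borel_measurable N"
    using measurable_compose[OF measurable_Pair2' measurable_kernel, of x] assms space_N
    using measurable_compose[OF measurable_Pair1' measurable_kernel, of x] by simp
  then show ?thesis
    by (subst measurable_cong[where g = "\<lambda>y. k y x"]) (auto simp: zero_ext_def space_N)
qed

lemma mem_measurable: "f \<in> H \<Longrightarrow> f \<in> borel_measurable N"
  by (rule measurable_mem[OF section_measurable])

lemma abs_le_kappa_ip_norm:
  assumes "f \<in> H" shows "\<bar>f x\<bar> \<le> \<kappa> * ip_norm ip f"
proof (cases "x \<in> S")
  case True
  then have "ip_norm ip f * sqrt (k x x) \<le> ip_norm ip f * \<kappa>"
    using assms by (intro mult_left_mono kernel_le ip_norm_nonneg)
  then show ?thesis using abs_le_ip_norm[OF assms True] by (simp add: mult.commute)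
next
  case False
  then show ?thesis using vanishes[OF assms] kappa_nonneg ip_norm_nonneg[OF assms] by simp
qed

lemma abs_kernel_le:
  assumes "x \<in> S" "y \<in> S" shows "\<bar>k y x\<bar> \<le> \<kappa>\<^sup>2"
proof -
  have "\<bar>zero_ext S (\<lambda>y. k y x) y\<bar> \<le> \<kappa> * ip_norm ip (zero_ext S (\<lambda>y. k y x))"
    by (intro abs_le_kappa_ip_norm section_mem assms)
  also have "\<dots> \<le> \<kappa> * \<kappa>"
    unfolding ip_norm_section[OF assms(1)] by (intro mult_left_mono kernel_le assms kappa_nonneg)
  finally show ?thesis using assms by (simp add: zero_ext_def power2_eq_square)
qed

end

text \<open>Negative values are allowed, so that the shifted loss, its smoothing and the linear
  losses \<open>h z * t\<close> are all instances. Together with the Lipschitz bound,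
  \<open>loss_zero\<close> makes the loss of a bounded function bounded and hence
  integrable.\<close>

locale lipschitz_convex_loss = prob_space Q
  for Q :: "'z measure" +
  fixes l :: "'z \<Rightarrow> real \<Rightarrow> real" and c :: real
  assumes loss_measurable: "(\<lambda>(z, t). l z t) \<in> borel_measurable (Q \<Otimes>\<^sub>M borel)"
    and loss_zero: "\<And>z. z \<in> space Q \<Longrightarrow> l z 0 = 0"
    and loss_lipschitz: "\<And>z s t. z \<in> space Q \<Longrightarrow> \<bar>l z s - l z t\<bar> \<le> c * \<bar>s - t\<bar>"
    and loss_convex: "\<And>z. z \<in> space Q \<Longrightarrow> convex_on UNIV (l z)"
begin

lemma lipschitz_nonneg: "0 \<le> c"
  using not_empty loss_lipschitz[of _ 1 0] by force

lemma loss_measurable':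
  "f \<in> borel_measurable Q \<Longrightarrow> (\<lambda>z. l z (f z)) \<in> borel_measurable Q"
  using measurable_compose[OF measurable_Pair[OF measurable_ident] loss_measurable] by simp

lemma smoothing_lipschitz_convex_loss:
  assumes "\<epsilon> > 0" shows "lipschitz_convex_loss Q (\<lambda>z. smoothing \<epsilon> (l z)) c"
proof
  fix z assume "z \<in> space Q"
  then interpret lipschitz_convex "l z" c \<epsilon>
    using assms loss_lipschitz loss_convex by unfold_locales
  show "smoothing \<epsilon> (l z) 0 = 0" by (rule smoothing_zero)
  show "\<bar>smoothing \<epsilon> (l z) s - smoothing \<epsilon> (l z) t\<bar> \<le> c * \<bar>s - t\<bar>" for s t
    by (rule smoothing_lipschitz)
  show "convex_on UNIV (smoothing \<epsilon> (l z))" by (rule smoothing_convex)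
qed (use borel_measurable_smoothing[OF loss_measurable] in simp)

text \<open>The SVM for this loss is the representer
  \<open>- E (h k(X, \<cdot>)) / (2 \<Lambda>)\<close>. Obtaining it as a minimizer takes the place
  of a vector-valued integral in \<open>H\<close>.\<close>

lemma linear_lipschitz_convex_loss:
  assumes "h \<in> borel_measurable Q" "\<And>z. z \<in> space Q \<Longrightarrow> \<bar>h z\<bar> \<le> c"
  shows "lipschitz_convex_loss Q (\<lambda>z t. h z * t) c"
proof
  note [measurable] = assms(1)
  show "(\<lambda>(z, t). h z * t) \<in> borel_measurable (Q \<Otimes>\<^sub>M borel)" by measurable
  show "\<bar>h z * s - h z * t\<bar> \<le> c * \<bar>s - t\<bar>" if "z \<in> space Q" for z s t
    using assms(2)[OF that] by (simp add: abs_mult mult_right_mono flip: right_diff_distrib)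
  show "convex_on UNIV ((*) (h z))" for z
    by (rule convex_on_of_subgradient[where h = "\<lambda>_. h z"]) (simp add: algebra_simps)
qed simp

end

section \<open>The SVM of an abstract loss: existence, norm bound and first-order condition\<close>

locale svm_problem =
  bounded_kernel_rkhs S k H ip N \<kappa> + lipschitz_convex_loss Q l c
  for S :: "'a set" and k H ip N \<kappa> and Q :: "'z measure" and l c +
  fixes \<xi> :: "'z \<Rightarrow> 'a" and \<Lambda> :: real
  assumes input_measurable: "\<xi> \<in> measurable Q N"
    and lambda_pos: "\<Lambda> > 0"
begin

definition risk :: "('a \<Rightarrow> real) \<Rightarrow> real" where
  "risk f = (\<integral>z. l z (f (\<xi> z)) \<partial>Q)"

definition is_svm :: "('a \<Rightarrow> real) \<Rightarrow> bool" where
  "is_svm f \<longleftrightarrow> f \<in> H \<and>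
     (\<forall>g\<in>H. risk f + \<Lambda> * (ip_norm ip f)\<^sup>2 \<le> risk g + \<Lambda> * (ip_norm ip g)\<^sup>2)"

lemma is_svm_mem: "is_svm f \<Longrightarrow> f \<in> H"
  by (simp add: is_svm_def)

lemma compose_input_measurable: "f \<in> H \<Longrightarrow> (\<lambda>z. f (\<xi> z)) \<in> borel_measurable Q"
  using measurable_compose[OF input_measurable mem_measurable] by simp

lemma loss_diff_le:
  assumes "f \<in> H" "g \<in> H" "z \<in> space Q"
  shows "\<bar>l z (f (\<xi> z)) - l z (g (\<xi> z))\<bar> \<le> c * \<kappa> * ip_norm ip (\<lambda>x. f x - g x)"
proof -
  have "\<bar>l z (f (\<xi> z)) - l z (g (\<xi> z))\<bar> \<le> c * \<bar>f (\<xi> z) - g (\<xi> z)\<bar>"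
    by (rule loss_lipschitz[OF assms(3)])
  also have "\<dots> \<le> c * (\<kappa> * ip_norm ip (\<lambda>x. f x - g x))"
    by (intro mult_left_mono abs_le_kappa_ip_norm[OF diff_mem[OF assms(1,2)]] lipschitz_nonneg)
  finally show ?thesis by (simp add: mult.assoc)
qed

lemma integrable_loss:
  assumes "f \<in> H" shows "integrable Q (\<lambda>z. l z (f (\<xi> z)))"
proof (rule integrable_const_bound[where B = "c * \<kappa> * ip_norm ip f"], rule AE_I2)
  show "norm (l z (f (\<xi> z))) \<le> c * \<kappa> * ip_norm ip f" if "z \<in> space Q" for z
    using loss_diff_le[OF assms zero_mem that] that loss_zero by simp
qed (use assms in \<open>simp add: loss_measurable' compose_input_measurable\<close>)

lemma integrable_mult_bounded:
  assumes "f \<in> H" "h \<in> borel_measurable Q" "\<And>z. z \<in> space Q \<Longrightarrow> \<bar>h z\<bar> \<le> d"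
  shows "integrable Q (\<lambda>z. h z * f (\<xi> z))"
proof (rule integrable_const_bound[where B = "d * (\<kappa> * ip_norm ip f)"], rule AE_I2)
  show "norm (h z * f (\<xi> z)) \<le> d * (\<kappa> * ip_norm ip f)" if "z \<in> space Q" for z
    unfolding real_norm_def abs_mult using assms(3)[OF that]
    by (intro mult_mono abs_le_kappa_ip_norm assms(1)) auto
qed (use assms compose_input_measurable in simp)

lemma risk_lipschitz:
  assumes "f \<in> H" "g \<in> H"
  shows "\<bar>risk f - risk g\<bar> \<le> c * \<kappa> * ip_norm ip (\<lambda>x. f x - g x)"
proof -
  let ?d = "\<lambda>z. l z (f (\<xi> z)) - l z (g (\<xi> z))"
  have "\<bar>risk f - risk g\<bar> = \<bar>\<integral>z. ?d z \<partial>Q\<bar>"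
    by (simp add: risk_def integrable_loss assms)
  also have "\<dots> \<le> (\<integral>z. \<bar>?d z\<bar> \<partial>Q)"
    using integral_norm_bound[of Q ?d] by simp
  also have "\<dots> \<le> c * \<kappa> * ip_norm ip (\<lambda>x. f x - g x)"
    using loss_diff_le[OF assms] by (intro integral_le_const AE_I2) (auto simp: integrable_loss assms)
  finally show ?thesis .
qed

lemma risk_convex:
  assumes "f \<in> H" "g \<in> H" "0 \<le> t" "t \<le> 1"
  shows "risk (\<lambda>x. (1 - t) * f x + t * g x) \<le> (1 - t) * risk f + t * risk g"
proof -
  have "risk (\<lambda>x. (1 - t) * f x + t * g x) \<le> (\<integral>z. (1 - t) * l z (f (\<xi> z)) + t * l z (g (\<xi> z)) \<partial>Q)"
    unfolding risk_def
  proof (rule Bochner_Integration.integral_mono)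
    show "integrable Q (\<lambda>z. l z ((1 - t) * f (\<xi> z) + t * g (\<xi> z)))"
      using integrable_loss[OF convex_combination_mem[OF assms(1,2)]] .
    show "l z ((1 - t) * f (\<xi> z) + t * g (\<xi> z)) \<le> (1 - t) * l z (f (\<xi> z)) + t * l z (g (\<xi> z))"
      if "z \<in> space Q" for z
      using convex_onD[OF loss_convex[OF that] assms(3,4)] by simp
  qed (simp add: integrable_loss assms)
  then show ?thesis by (simp add: risk_def integrable_loss assms)
qed

text \<open>For \<open>V = H\<close> the closedness condition of
  \<open>ex_regularized_minimizer\<close> is trivial; proper subspaces \<open>V\<close> occur in
  \<open>measurable_mem\<close>.\<close>

lemma ex_svm: "\<exists>f. is_svm f"
proof -
  have "\<exists>f\<in>H. \<forall>g\<in>H. risk f + \<Lambda> * (ip_norm ip f)\<^sup>2 \<le> risk g + \<Lambda> * (ip_norm ip g)\<^sup>2"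
    by (rule ex_regularized_minimizer[OF complete lambda_pos subset_refl zero_mem convex_combination_mem
          _ risk_lipschitz risk_convex])
  then show ?thesis by (auto simp: is_svm_def)
qed

lemma svm_gap:
  assumes "is_svm f" "g \<in> H"
  shows "\<Lambda> * (ip_norm ip (\<lambda>x. g x - f x))\<^sup>2 \<le>
    (risk g + \<Lambda> * (ip_norm ip g)\<^sup>2) - (risk f + \<Lambda> * (ip_norm ip f)\<^sup>2)"
  using assms by (intro regularized_minimizer_gap[OF lambda_pos] risk_convex) (auto simp: is_svm_def)

text \<open>Comparison with the zero function bounds the penalty by a decrease of risk, which is at
  most linear in the norm; one factor of the norm cancels.\<close>

lemma svm_norm_le:
  assumes "is_svm f" shows "ip_norm ip f \<le> c * \<kappa> / \<Lambda>"
proof -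
  have f: "f \<in> H" using assms by (rule is_svm_mem)
  have "\<Lambda> * (ip_norm ip f)\<^sup>2 \<le> risk (\<lambda>x. 0) - risk f"
    using assms zero_mem by (auto simp: is_svm_def ip_norm_zero dest!: bspec[of _ _ "\<lambda>x. 0"])
  also have "\<dots> \<le> c * \<kappa> * ip_norm ip f"
    using risk_lipschitz[OF f zero_mem] by simp
  finally have "ip_norm ip f * (\<Lambda> * ip_norm ip f) \<le> ip_norm ip f * (c * \<kappa>)"
    by (simp add: power2_eq_square mult.commute mult.left_commute)
  then show ?thesis
    using ip_norm_nonneg[OF f] lambda_pos lipschitz_nonneg kappa_nonneg
    by (cases "ip_norm ip f = 0") (auto simp: pos_le_divide_eq mult.commute)
qed

text \<open>The quadratic upper bound on the loss along \<^term>\<open>f\<close> makes \<^term>\<open>h\<close> the derivative of the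
  loss, and the identity is the weak form of the representer theorem.\<close>

lemma svm_first_order:
  assumes svm: "is_svm f" and v: "v \<in> H"
    and h: "h \<in> borel_measurable Q" "\<And>z. z \<in> space Q \<Longrightarrow> \<bar>h z\<bar> \<le> d" and "0 \<le> A"
    and expansion: "\<And>z s. z \<in> space Q \<Longrightarrow>
      l z (f (\<xi> z) + s) \<le> l z (f (\<xi> z)) + h z * s + A * s\<^sup>2"
  shows "2 * \<Lambda> * ip f v = - (\<integral>z. h z * v (\<xi> z) \<partial>Q)"
proof (rule regularized_minimizer_first_order[where V = H and R = risk])
  have f: "f \<in> H" using svm by (rule is_svm_mem)
  show "f \<in> H" "v \<in> H" by fact+
  show "risk f + \<Lambda> * (ip_norm ip f)\<^sup>2 \<le> risk g + \<Lambda> * (ip_norm ip g)\<^sup>2" if "g \<in> H" for g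
    using svm that by (simp add: is_svm_def)
  show mem: "(\<lambda>x. f x + t * v x) \<in> H" for t
    by (intro add_mem scale_mem f v)
  \<comment> \<open>This uniform bound on \<open>v\<close> makes the quadratic remainder independent
    of \<open>z\<close>.\<close>
  let ?K = "\<kappa> * ip_norm ip v"
  note int = integrable_loss[OF f] integrable_mult_bounded[OF v h]
  show "risk (\<lambda>x. f x + t * v x) \<le> risk f + t * (\<integral>z. h z * v (\<xi> z) \<partial>Q) + A * ?K\<^sup>2 * t\<^sup>2" for t
  proof -
    have "risk (\<lambda>x. f x + t * v x) \<le>
        (\<integral>z. l z (f (\<xi> z)) + t * (h z * v (\<xi> z)) + A * ?K\<^sup>2 * t\<^sup>2 \<partial>Q)"
      unfolding risk_def
    proof (rule Bochner_Integration.integral_mono)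
      show "integrable Q (\<lambda>z. l z (f (\<xi> z) + t * v (\<xi> z)))"
        using integrable_loss[OF mem] .
      show "l z (f (\<xi> z) + t * v (\<xi> z)) \<le> l z (f (\<xi> z)) + t * (h z * v (\<xi> z)) + A * ?K\<^sup>2 * t\<^sup>2"
        if "z \<in> space Q" for z
      proof -
        have "(v (\<xi> z))\<^sup>2 \<le> ?K\<^sup>2"
          using abs_le_kappa_ip_norm[OF v, of "\<xi> z"] by (subst abs_le_square_iff[symmetric]) linarith
        then have "A * (t * v (\<xi> z))\<^sup>2 \<le> A * ?K\<^sup>2 * t\<^sup>2"
          using \<open>0 \<le> A\<close> mult_mono[of "(v (\<xi> z))\<^sup>2" "?K\<^sup>2" "t\<^sup>2" "t\<^sup>2"]
          by (simp add: power_mult_distrib mult_left_mono mult.assoc mult.commute[of "t\<^sup>2"])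
        then show ?thesis using expansion[OF that, of "t * v (\<xi> z)"]
          by (simp add: mult.left_commute)
      qed
    qed (use int in simp)
    also have "\<dots> = risk f + t * (\<integral>z. h z * v (\<xi> z) \<partial>Q) + A * ?K\<^sup>2 * t\<^sup>2"
      using int by (simp add: risk_def prob_space)
    finally show ?thesis .
  qed
qed

end

text \<open>Each SVM is inserted into the gap inequality of the other. The risks combine to the
  integral of one function, bounded by \<open>c * \<kappa> * n\<close>, against the difference of
  the measures. The penalties leave a difference of squared norms, which is also linear in
  \<open>n\<close> by \<open>svm_norm_le\<close>. Hence one factor \<open>n\<close> cancels from the
  quadratic lower bound.\<close>

lemma svm_diff_same_kernel:
  assumes P1: "svm_problem S k H ip N \<kappa> Q1 l c \<xi> \<Lambda>\<^sub>1" and P2: "svm_problem S k H ip N \<kappa> Q2 l c \<xi> \<Lambda>\<^sub>2"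
    and sets: "sets Q2 = sets Q1"
    and f1: "svm_problem.is_svm H ip Q1 l \<xi> \<Lambda>\<^sub>1 f1" and f2: "svm_problem.is_svm H ip Q2 l \<xi> \<Lambda>\<^sub>2 f2"
    and \<tau>: "0 < \<tau>" "\<tau> \<le> \<Lambda>\<^sub>1" "\<tau> \<le> \<Lambda>\<^sub>2"
  shows "\<bar>f1 x - f2 x\<bar> \<le>
    c * (\<kappa>\<^sup>2 / \<tau> * tv_norm Q1 (\<lambda>E. measure Q1 E - measure Q2 E) + \<kappa>\<^sup>2 / \<tau>\<^sup>2 * \<bar>\<Lambda>\<^sub>1 - \<Lambda>\<^sub>2\<bar>)"
proof -
  interpret P1: svm_problem S k H ip N \<kappa> Q1 l c \<xi> \<Lambda>\<^sub>1 by fact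
  interpret P2: svm_problem S k H ip N \<kappa> Q2 l c \<xi> \<Lambda>\<^sub>2 by fact
  note f = P1.is_svm_mem[OF f1] P2.is_svm_mem[OF f2]
  define n where "n = ip_norm ip (\<lambda>x. f1 x - f2 x)"
  define tv where "tv = tv_norm Q1 (\<lambda>E. measure Q1 E - measure Q2 E)"
  have n0: "0 \<le> n" unfolding n_def by (intro P1.ip_norm_nonneg P1.diff_mem f)
  have fin: "finite_measure Q1" "finite_measure Q2" by unfold_locales
  have tv0: "0 \<le> tv"
    unfolding tv_def by (rule tv_norm_nonneg[OF fin sets])
  have nc: "ip_norm ip (\<lambda>x. f2 x - f1 x) = n" unfolding n_def by (rule P1.ip_norm_diff_commute) fact+
  note nonneg = P1.lipschitz_nonneg P1.kappa_nonneg
  let ?u = "\<lambda>z. l z (f2 (\<xi> z)) - l z (f1 (\<xi> z))"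
  have "(\<Lambda>\<^sub>1 + \<Lambda>\<^sub>2) * n\<^sup>2 \<le> (P1.risk f2 - P1.risk f1) - (P2.risk f2 - P2.risk f1)
      + (\<Lambda>\<^sub>1 - \<Lambda>\<^sub>2) * ((ip_norm ip f2)\<^sup>2 - (ip_norm ip f1)\<^sup>2)"
    using P1.svm_gap[OF f1 f(2)] P2.svm_gap[OF f2 f(1)] unfolding nc n_def[symmetric]
    by (simp add: algebra_simps)
  moreover have "(P1.risk f2 - P1.risk f1) - (P2.risk f2 - P2.risk f1) = (\<integral>z. ?u z \<partial>Q1) - (\<integral>z. ?u z \<partial>Q2)"
    using f by (simp add: P1.risk_def P2.risk_def P1.integrable_loss P2.integrable_loss)
  moreover have "(\<integral>z. ?u z \<partial>Q1) - (\<integral>z. ?u z \<partial>Q2) \<le> c * \<kappa> * n * tv"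
    unfolding tv_def
  proof (rule integral_diff_le_tv_norm[OF fin sets])
    show "0 \<le> c * \<kappa> * n" using nonneg n0 by simp
    show "\<bar>?u z\<bar> \<le> c * \<kappa> * n" if "z \<in> space Q1" for z
      using P1.loss_diff_le[OF f(2,1) that] nc by simp
  qed (intro borel_measurable_diff P1.loss_measurable' P1.compose_input_measurable f)
  moreover have "(\<Lambda>\<^sub>1 - \<Lambda>\<^sub>2) * ((ip_norm ip f2)\<^sup>2 - (ip_norm ip f1)\<^sup>2) \<le> \<bar>\<Lambda>\<^sub>1 - \<Lambda>\<^sub>2\<bar> * (n * (2 * (c * \<kappa> / \<tau>)))"
  proof -
    have b: "c * \<kappa> / \<Lambda>\<^sub>1 \<le> c * \<kappa> / \<tau>" "c * \<kappa> / \<Lambda>\<^sub>2 \<le> c * \<kappa> / \<tau>"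
      using \<tau> nonneg by (auto intro!: divide_left_mono)
    have le: "ip_norm ip f1 \<le> c * \<kappa> / \<tau>" "ip_norm ip f2 \<le> c * \<kappa> / \<tau>"
      using P1.svm_norm_le[OF f1] P2.svm_norm_le[OF f2] b by linarith+
    have factor: "(ip_norm ip f2)\<^sup>2 - (ip_norm ip f1)\<^sup>2
        = (ip_norm ip f2 - ip_norm ip f1) * (ip_norm ip f2 + ip_norm ip f1)"
      by (simp add: power2_eq_square algebra_simps)
    have "(\<Lambda>\<^sub>1 - \<Lambda>\<^sub>2) * ((ip_norm ip f2)\<^sup>2 - (ip_norm ip f1)\<^sup>2)
        \<le> \<bar>(\<Lambda>\<^sub>1 - \<Lambda>\<^sub>2) * ((ip_norm ip f2)\<^sup>2 - (ip_norm ip f1)\<^sup>2)\<bar>" by simp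
    also have "\<dots> \<le> \<bar>\<Lambda>\<^sub>1 - \<Lambda>\<^sub>2\<bar> * (n * (2 * (c * \<kappa> / \<tau>)))"
      unfolding factor abs_mult
      using P1.ip_norm_abs_diff_le[OF f(2,1)] nc n0 le P1.ip_norm_nonneg f
      by (intro mult_left_mono mult_mono) auto
    finally show ?thesis .
  qed
  ultimately have "(\<Lambda>\<^sub>1 + \<Lambda>\<^sub>2) * n\<^sup>2 \<le> n * (c * \<kappa> * tv + \<bar>\<Lambda>\<^sub>1 - \<Lambda>\<^sub>2\<bar> * (2 * (c * \<kappa> / \<tau>)))"
    by (simp add: algebra_simps)
  moreover have "2 * \<tau> * n\<^sup>2 \<le> (\<Lambda>\<^sub>1 + \<Lambda>\<^sub>2) * n\<^sup>2"
    using \<tau> by (intro mult_right_mono) auto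
  ultimately have "n * (2 * \<tau> * n) \<le> n * (c * \<kappa> * tv + \<bar>\<Lambda>\<^sub>1 - \<Lambda>\<^sub>2\<bar> * (2 * (c * \<kappa> / \<tau>)))"
    by (simp add: power2_eq_square mult.commute mult.left_commute)
  \<comment> \<open>The total variation term arises with coefficient 1 and is enlarged to 2, so that
    a common factor 2 cancels and the constants of the claim remain.\<close>
  then have "2 * \<tau> * n \<le> 2 * (c * \<kappa> * tv + \<bar>\<Lambda>\<^sub>1 - \<Lambda>\<^sub>2\<bar> * (c * \<kappa> / \<tau>))"
  proof (cases "n = 0")
    case False
    assume "n * (2 * \<tau> * n) \<le> n * (c * \<kappa> * tv + \<bar>\<Lambda>\<^sub>1 - \<Lambda>\<^sub>2\<bar> * (2 * (c * \<kappa> / \<tau>)))"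
    then have "2 * \<tau> * n \<le> c * \<kappa> * tv + \<bar>\<Lambda>\<^sub>1 - \<Lambda>\<^sub>2\<bar> * (2 * (c * \<kappa> / \<tau>))"
      by (rule mult_left_le_imp_le) (use False n0 in simp)
    moreover have "0 \<le> c * \<kappa> * tv" using nonneg tv0 by simp
    ultimately show ?thesis by (simp add: algebra_simps)
  qed (use nonneg tv0 \<tau> in simp)
  then have "n * \<tau> \<le> c * \<kappa> * tv + \<bar>\<Lambda>\<^sub>1 - \<Lambda>\<^sub>2\<bar> * (c * \<kappa> / \<tau>)"
    unfolding mult.assoc mult.commute[of n] mult_le_cancel_left_pos[OF zero_less_numeral] .
  then have n: "n \<le> (c * \<kappa> * tv + \<bar>\<Lambda>\<^sub>1 - \<Lambda>\<^sub>2\<bar> * (c * \<kappa> / \<tau>)) / \<tau>"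
    unfolding pos_le_divide_eq[OF \<tau>(1)] .
  have "\<bar>f1 x - f2 x\<bar> \<le> \<kappa> * n"
    unfolding n_def by (intro P1.abs_le_kappa_ip_norm P1.diff_mem f)
  also have "\<dots> \<le> \<kappa> * ((c * \<kappa> * tv + \<bar>\<Lambda>\<^sub>1 - \<Lambda>\<^sub>2\<bar> * (c * \<kappa> / \<tau>)) / \<tau>)"
    using n nonneg by (intro mult_left_mono)
  also have "\<dots> = c * (\<kappa>\<^sup>2 / \<tau> * tv + \<kappa>\<^sup>2 / \<tau>\<^sup>2 * \<bar>\<Lambda>\<^sub>1 - \<Lambda>\<^sub>2\<bar>)"
    using \<tau> by (simp add: power2_eq_square field_simps)
  finally show ?thesis by (simp add: tv_def)
qed


section \<open>Changing the kernel\<close>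

text \<open>The subgradient inequality at \<open>t + s\<close>, read at \<open>t\<close>, is an
  upper bound with the derivative at the wrong point. Moving the derivative back to \<open>t\<close>
  costs its Lipschitz constant times \<open>s\<^sup>2\<close>.\<close>

lemma (in svm_problem) smoothing_expansion:
  assumes "\<epsilon> > 0" "z \<in> space Q"
  shows "smoothing \<epsilon> (l z) (t + s) \<le>
    smoothing \<epsilon> (l z) t + smoothing_deriv \<epsilon> (l z) t * s + 2 * c / \<epsilon> * s\<^sup>2"
proof -
  interpret lipschitz_convex "l z" c \<epsilon>
    using assms loss_lipschitz loss_convex by unfold_locales
  have "smoothing \<epsilon> (l z) (t + s) + smoothing_deriv \<epsilon> (l z) (t + s) * (- s) \<le> smoothing \<epsilon> (l z) t"
    using smoothing_subgradient[of "t + s" t] by simp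
  moreover have "(smoothing_deriv \<epsilon> (l z) (t + s) - smoothing_deriv \<epsilon> (l z) t) * s \<le> 2 * c / \<epsilon> * s\<^sup>2"
  proof -
    have "(smoothing_deriv \<epsilon> (l z) (t + s) - smoothing_deriv \<epsilon> (l z) t) * s
        \<le> \<bar>smoothing_deriv \<epsilon> (l z) (t + s) - smoothing_deriv \<epsilon> (l z) t\<bar> * \<bar>s\<bar>"
      by (simp flip: abs_mult)
    also have "\<dots> \<le> 2 * c / \<epsilon> * \<bar>s\<bar> * \<bar>s\<bar>"
      using smoothing_deriv_lipschitz[of "t + s" t] by (intro mult_right_mono) auto
    finally show ?thesis by (simp add: power2_eq_square mult.assoc)
  qed
  ultimately show ?thesis by (simp add: algebra_simps)
qed

text \<open>With \<^term>\<open>h\<close> the derivative of the smoothed loss at the smoothed SVM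
  \<^term>\<open>f\<^sub>\<epsilon>\<close> for \<^term>\<open>k2\<close>, the comparison function \<^term>\<open>g\<close> is the function that
  the representer formula assigns to \<^term>\<open>h\<close> and the kernel \<^term>\<open>k1\<close>.\<close>

lemma svm_diff_same_measure_approx:
  assumes P1: "svm_problem S k1 H1 ip1 N \<kappa> Q l c \<xi> \<Lambda>" and P2: "svm_problem S k2 H2 ip2 N \<kappa> Q l c \<xi> \<Lambda>"
    and f1: "svm_problem.is_svm H1 ip1 Q l \<xi> \<Lambda> f1" and f2: "svm_problem.is_svm H2 ip2 Q l \<xi> \<Lambda> f2"
    and p: "1 \<le> p" and \<epsilon>: "\<epsilon> > 0"
  defines "D \<equiv> Lp_norm p (distr Q N \<xi> \<Otimes>\<^sub>M distr Q N \<xi>) (\<lambda>(x, y). k1 x y - k2 x y)"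
  shows "Lp_norm p (distr Q N \<xi>) (\<lambda>x. f1 x - f2 x) \<le>
    \<kappa> * sqrt (c\<^sup>2 / (2 * \<Lambda>\<^sup>2) * D + 2 * c * \<epsilon> / \<Lambda>) + \<kappa> * sqrt (4 * c * \<epsilon> / \<Lambda>) + c / (2 * \<Lambda>) * D"
proof -
  interpret P1: svm_problem S k1 H1 ip1 N \<kappa> Q l c \<xi> \<Lambda> by fact
  interpret P2: svm_problem S k2 H2 ip2 N \<kappa> Q l c \<xi> \<Lambda> by fact
  define \<mu> where "\<mu> = distr Q N \<xi>"
  interpret \<mu>: prob_space \<mu>
    unfolding \<mu>_def by (rule P1.prob_space_distr[OF P1.input_measurable])
  have space_\<mu>: "space \<mu> = S" by (simp add: \<mu>_def P1.space_N)
  have meas_\<mu>: "v \<in> borel_measurable \<mu> \<longleftrightarrow> v \<in> borel_measurable N" for v :: "'a \<Rightarrow> real"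
    by (simp add: \<mu>_def)
  have in_S: "\<xi> z \<in> S" if "z \<in> space Q" for z
    using measurable_space[OF P1.input_measurable that] by (simp add: P1.space_N)
  note \<Lambda> = P1.lambda_pos and c = P1.lipschitz_nonneg and \<kappa> = P1.kappa_nonneg
  interpret LE: lipschitz_convex_loss Q "\<lambda>z. smoothing \<epsilon> (l z)" c
    by (rule P1.smoothing_lipschitz_convex_loss[OF \<epsilon>])
  interpret PE: svm_problem S k2 H2 ip2 N \<kappa> Q "\<lambda>z. smoothing \<epsilon> (l z)" c \<xi> \<Lambda>
    by unfold_locales (rule P1.input_measurable \<Lambda>)+
  obtain f\<epsilon> where f\<epsilon>: "PE.is_svm f\<epsilon>" using PE.ex_svm by blast
  note f1H = P1.is_svm_mem[OF f1] and f2H = P2.is_svm_mem[OF f2] and f\<epsilon>H = PE.is_svm_mem[OF f\<epsilon>]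
  have lc: "lipschitz_convex (l z) c \<epsilon>" if "z \<in> space Q" for z
    using that \<epsilon> P1.loss_lipschitz P1.loss_convex by unfold_locales
  have close: "\<bar>smoothing \<epsilon> (l z) t - l z t\<bar> \<le> 2 * c * \<epsilon>" if "z \<in> space Q" for z t
    using lipschitz_convex.smoothing_close[OF lc[OF that], of t] P1.loss_zero[OF that] by simp
  define h where "h z = smoothing_deriv \<epsilon> (l z) (f\<epsilon> (\<xi> z))" for z
  have h_meas: "h \<in> borel_measurable Q"
    unfolding h_def smoothing_deriv_def
    by (intro borel_measurable_divide borel_measurable_diff P1.loss_measurable' borel_measurable_add
        borel_measurable_const P2.compose_input_measurable f\<epsilon>H)
  have h_le: "\<bar>h z\<bar> \<le> c" if "z \<in> space Q" for z
    unfolding h_def by (rule lipschitz_convex.smoothing_deriv_abs_le[OF lc[OF that]])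
  have foc_f: "2 * \<Lambda> * ip2 f\<epsilon> v = - (\<integral>z. h z * v (\<xi> z) \<partial>Q)" if "v \<in> H2" for v
    using PE.svm_first_order[OF f\<epsilon> that h_meas h_le, where A = "2 * c / \<epsilon>"]
      P1.smoothing_expansion[OF \<epsilon>] c \<epsilon> by (simp add: h_def)
  interpret LG: lipschitz_convex_loss Q "\<lambda>z t. h z * t" c
    by (rule P1.linear_lipschitz_convex_loss[OF h_meas h_le])
  interpret PG: svm_problem S k1 H1 ip1 N \<kappa> Q "\<lambda>z t. h z * t" c \<xi> \<Lambda>
    by unfold_locales (rule P1.input_measurable \<Lambda>)+
  \<comment> \<open>As the minimizer for the linear loss, \<open>g\<close> satisfies the same weak
    equation as \<open>f\<epsilon>\<close>, with test functions from \<open>H1\<close> in place of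
    \<open>H2\<close>.\<close>
  obtain g where g: "PG.is_svm g" using PG.ex_svm by blast
  note gH = PG.is_svm_mem[OF g]
  have foc_g: "2 * \<Lambda> * ip1 g v = - (\<integral>z. h z * v (\<xi> z) \<partial>Q)" if "v \<in> H1" for v
    using PG.svm_first_order[OF g that h_meas h_le, where A = 0] by (simp add: distrib_left)
  define u where "u x = g x - f\<epsilon> x" for x
  define K where "K x = (\<integral>y. \<bar>k1 x y - k2 x y\<bar> \<partial>\<mu>)" for x
  have k_meas: "(\<lambda>(x, y). k1 x y - k2 x y) \<in> borel_measurable (N \<Otimes>\<^sub>M N)"
    using borel_measurable_diff[OF P1.measurable_kernel P2.measurable_kernel]
    by (simp add: case_prod_beta)
  have k_le: "\<bar>k1 x y - k2 x y\<bar> \<le> 2 * \<kappa>\<^sup>2" if "x \<in> S" "y \<in> S" for x y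
    using P1.abs_kernel_le[OF that(2,1)] P2.abs_kernel_le[OF that(2,1)] by linarith
  \<comment> \<open>Tested with the two kernel sections at \<open>x\<close>, the weak equations
    express \<open>u x\<close> as an average of the kernel difference with weight \<open>h\<close>,
    divided by \<open>2 * \<Lambda>\<close>.\<close>
  have u_le: "\<bar>u x\<bar> \<le> c / (2 * \<Lambda>) * K x" if x: "x \<in> S" for x
  proof -
    let ?s1 = "zero_ext S (\<lambda>y. k1 y x)" and ?s2 = "zero_ext S (\<lambda>y. k2 y x)"
    note s = P1.section_mem[OF x] P2.section_mem[OF x]
    note int = P1.integrable_mult_bounded[OF s(1) h_meas h_le] P2.integrable_mult_bounded[OF s(2) h_meas h_le]
    have k_meas': "(\<lambda>y. \<bar>k1 x y - k2 x y\<bar>) \<in> borel_measurable N"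
      using measurable_compose[OF measurable_Pair1' k_meas, of x] x P1.space_N by simp
    have "2 * \<Lambda> * u x = - (\<integral>z. h z * (?s1 (\<xi> z) - ?s2 (\<xi> z)) \<partial>Q)"
      using foc_g[OF s(1)] foc_f[OF s(2)] P1.reproducing[OF gH x] P2.reproducing[OF f\<epsilon>H x] int
      by (simp add: u_def right_diff_distrib)
    then have "2 * \<Lambda> * \<bar>u x\<bar> = \<bar>\<integral>z. h z * (?s1 (\<xi> z) - ?s2 (\<xi> z)) \<partial>Q\<bar>"
      using \<Lambda> by (metis abs_minus_cancel abs_mult abs_of_pos mult_pos_pos zero_less_numeral)
    also have "\<dots> \<le> (\<integral>z. \<bar>h z * (?s1 (\<xi> z) - ?s2 (\<xi> z))\<bar> \<partial>Q)"
      using integral_norm_bound[of Q "\<lambda>z. h z * (?s1 (\<xi> z) - ?s2 (\<xi> z))"] by simp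
    also have "\<dots> \<le> (\<integral>z. c * \<bar>k1 x (\<xi> z) - k2 x (\<xi> z)\<bar> \<partial>Q)"
    proof (rule Bochner_Integration.integral_mono)
      show "integrable Q (\<lambda>z. \<bar>h z * (?s1 (\<xi> z) - ?s2 (\<xi> z))\<bar>)"
        using int by (auto simp: right_diff_distrib)
      have "integrable Q (\<lambda>z. \<bar>k1 x (\<xi> z) - k2 x (\<xi> z)\<bar>)"
      proof (rule P1.integrable_const_bound[where B = "2 * \<kappa>\<^sup>2"], rule AE_I2)
        show "norm \<bar>k1 x (\<xi> z) - k2 x (\<xi> z)\<bar> \<le> 2 * \<kappa>\<^sup>2" if "z \<in> space Q" for z
          using k_le[OF x in_S[OF that]] by simp
      qed (rule measurable_compose[OF P1.input_measurable k_meas'])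
      then show "integrable Q (\<lambda>z. c * \<bar>k1 x (\<xi> z) - k2 x (\<xi> z)\<bar>)" by simp
      show "\<bar>h z * (?s1 (\<xi> z) - ?s2 (\<xi> z))\<bar> \<le> c * \<bar>k1 x (\<xi> z) - k2 x (\<xi> z)\<bar>" if "z \<in> space Q" for z
        using h_le[OF that] in_S[OF that] x P1.kernel_commute[OF x in_S[OF that]] P2.kernel_commute[OF x in_S[OF that]]
        by (simp add: abs_mult zero_ext_def mult_right_mono)
    qed
    also have "\<dots> = c * K x"
      using k_meas' P1.input_measurable by (simp add: K_def \<mu>_def integral_distr)
    finally show ?thesis using \<Lambda> by (simp add: field_simps)
  qed
  have u_meas: "u \<in> borel_measurable \<mu>"
    unfolding meas_\<mu> u_def by (intro borel_measurable_diff P1.mem_measurable P2.mem_measurable gH f\<epsilon>H)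
  have u_bound: "\<bar>u x\<bar> \<le> \<kappa> * ip_norm ip1 g + \<kappa> * ip_norm ip2 f\<epsilon>" for x
    using P1.abs_le_kappa_ip_norm[OF gH, of x] P2.abs_le_kappa_ip_norm[OF f\<epsilon>H, of x] by (simp add: u_def)
  have k_meas_\<mu>: "(\<lambda>(x, y). \<bar>k1 x y - k2 x y\<bar>) \<in> borel_measurable (\<mu> \<Otimes>\<^sub>M \<mu>)"
    using borel_measurable_abs[OF k_meas] measurable_cong_sets[OF sets_pair_measure_cong[of \<mu> N \<mu> N] refl]
    by (auto simp: \<mu>_def case_prod_beta)
  have Lp_u: "Lp_norm p \<mu> u \<le> c / (2 * \<Lambda>) * D"
  proof -
    have "Lp_norm p \<mu> u \<le> Lp_norm p \<mu> (\<lambda>x. c / (2 * \<Lambda>) * K x)"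
    proof (rule \<mu>.Lp_norm_mono)
      show K_meas: "(\<lambda>x. c / (2 * \<Lambda>) * K x) \<in> borel_measurable \<mu>"
        unfolding K_def using k_meas_\<mu> by (intro borel_measurable_times borel_measurable_const
            \<mu>.borel_measurable_lebesgue_integral) 
      have K0: "0 \<le> K x" for x unfolding K_def by simp
      have K_le: "K x \<le> 2 * \<kappa>\<^sup>2" if "x \<in> S" for x
      proof -
        have "(\<lambda>y. \<bar>k1 x y - k2 x y\<bar>) \<in> borel_measurable \<mu>"
          using measurable_compose[OF measurable_Pair1' k_meas_\<mu>, of x] that space_\<mu> by simp
        then show ?thesis
          unfolding K_def using k_le[OF that] space_\<mu>
          by (intro \<mu>.integral_le_const \<mu>.integrable_const_bound[where B = "2 * \<kappa>\<^sup>2"] AE_I2) auto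
      qed
      show "\<bar>c / (2 * \<Lambda>) * K x\<bar> \<le> c / (2 * \<Lambda>) * (2 * \<kappa>\<^sup>2)" if "x \<in> space \<mu>" for x
      proof -
        have "0 \<le> c / (2 * \<Lambda>) * K x" using c \<Lambda> K0[of x] by simp
        moreover have "c / (2 * \<Lambda>) * K x \<le> c / (2 * \<Lambda>) * (2 * \<kappa>\<^sup>2)"
          using K_le[of x] that c \<Lambda> space_\<mu> by (intro mult_left_mono) auto
        ultimately show ?thesis by linarith
      qed
      show "\<bar>u x\<bar> \<le> \<bar>c / (2 * \<Lambda>) * K x\<bar>" if "x \<in> space \<mu>" for x
        by (rule order_trans[OF u_le abs_ge_self]) (use that space_\<mu> in simp)
    qed (use p in simp)
    also have "\<dots> = c / (2 * \<Lambda>) * Lp_norm p \<mu> K"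
      using p c \<Lambda> by (subst Lp_norm_cmult) auto
    also have "Lp_norm p \<mu> K \<le> Lp_norm p (\<mu> \<Otimes>\<^sub>M \<mu>) (\<lambda>(x, y). \<bar>k1 x y - k2 x y\<bar>)"
      unfolding K_def using k_le space_\<mu> by (intro \<mu>.Lp_norm_expectation_le[OF p k_meas_\<mu>]) auto
    also have "\<dots> = D"
      by (simp add: D_def \<mu>_def Lp_norm_def case_prod_beta)
    finally show ?thesis using c \<Lambda> mult_left_mono[of _ _ "c / (2 * \<Lambda>)"] by simp
  qed
  define \<Delta> where "\<Delta> = (\<integral>z. \<bar>u (\<xi> z)\<bar> \<partial>Q)"
  have \<Delta>_le: "\<Delta> \<le> c / (2 * \<Lambda>) * D"
  proof -
    have "\<Delta> = (\<integral>x. \<bar>u x\<bar> \<partial>\<mu>)"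
      unfolding \<Delta>_def \<mu>_def using u_meas P1.input_measurable
      by (subst integral_distr) (auto simp: meas_\<mu>)
    also have "\<dots> \<le> Lp_norm p \<mu> u"
      by (rule \<mu>.expectation_abs_le_Lp_norm[OF p u_meas u_bound])
    finally show ?thesis using Lp_u by simp
  qed
  have int_u: "integrable Q (\<lambda>z. \<bar>u (\<xi> z)\<bar>)"
    using u_bound u_meas measurable_compose[OF P1.input_measurable, of u borel]
    by (intro P1.integrable_const_bound[where B = "\<kappa> * ip_norm ip1 g + \<kappa> * ip_norm ip2 f\<epsilon>"] AE_I2)
      (simp_all add: meas_\<mu>)
  define n where "n = ip_norm ip1 (\<lambda>x. g x - f1 x)"
  define m where "m = ip_norm ip2 (\<lambda>x. f\<epsilon> x - f2 x)"
  have n0: "0 \<le> n" unfolding n_def by (intro P1.ip_norm_nonneg P1.diff_mem gH f1H)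
  have m0: "0 \<le> m" unfolding m_def by (intro P2.ip_norm_nonneg P2.diff_mem f\<epsilon>H f2H)
  \<comment> \<open>The gap inequality for \<open>f1\<close> is applied to \<open>g\<close>, which
    is admissible because \<open>g\<close> lies in \<open>H1\<close>. It remains to bound the excess
    objective of \<open>g\<close> by \<open>\<Delta>\<close> and \<open>\<epsilon>\<close>.\<close>
  have n_le: "n \<le> sqrt (c\<^sup>2 / (2 * \<Lambda>\<^sup>2) * D + 2 * c * \<epsilon> / \<Lambda>)"
  proof -
    have "P1.risk g - P1.risk f1 = (\<integral>z. l z (g (\<xi> z)) - l z (f1 (\<xi> z)) \<partial>Q)"
      by (simp add: P1.risk_def P1.integrable_loss gH f1H)
    \<comment> \<open>\<open>f\<epsilon>\<close> replaces \<open>g\<close> twice, once in the loss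
      and once in the linear term, at a cost of \<open>c * \<bar>u (\<xi> z)\<bar>\<close> each;
      smoothing at \<open>f\<epsilon>\<close> and at \<open>f1\<close> costs
      \<open>2 * c * \<epsilon>\<close> each.\<close>
    also have "\<dots> \<le> (\<integral>z. 2 * c * \<bar>u (\<xi> z)\<bar> + 4 * c * \<epsilon> + h z * (g (\<xi> z) - f1 (\<xi> z)) \<partial>Q)"
    proof (rule Bochner_Integration.integral_mono)
      show "integrable Q (\<lambda>z. 2 * c * \<bar>u (\<xi> z)\<bar> + 4 * c * \<epsilon> + h z * (g (\<xi> z) - f1 (\<xi> z)))"
        using int_u P1.integrable_mult_bounded[OF P1.diff_mem[OF gH f1H] h_meas h_le] by simp
      fix z assume z: "z \<in> space Q"
      have "l z (g (\<xi> z)) - l z (f\<epsilon> (\<xi> z)) \<le> c * \<bar>u (\<xi> z)\<bar>"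
        using P1.loss_lipschitz[OF z, of "g (\<xi> z)" "f\<epsilon> (\<xi> z)"] by (simp add: u_def)
      moreover have "smoothing \<epsilon> (l z) (f\<epsilon> (\<xi> z)) - smoothing \<epsilon> (l z) (f1 (\<xi> z)) \<le> h z * (f\<epsilon> (\<xi> z) - f1 (\<xi> z))"
        using lipschitz_convex.smoothing_subgradient[OF lc[OF z], of "f\<epsilon> (\<xi> z)" "f1 (\<xi> z)"]
        by (simp add: h_def algebra_simps)
      moreover have "h z * (f\<epsilon> (\<xi> z) - f1 (\<xi> z)) = h z * (g (\<xi> z) - f1 (\<xi> z)) - h z * u (\<xi> z)"
        by (simp add: u_def algebra_simps)
      moreover have "- (h z * u (\<xi> z)) \<le> c * \<bar>u (\<xi> z)\<bar>"
        using mult_right_mono[OF h_le[OF z], of "\<bar>u (\<xi> z)\<bar>"] by (simp flip: abs_mult)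
      ultimately show "l z (g (\<xi> z)) - l z (f1 (\<xi> z)) \<le> 2 * c * \<bar>u (\<xi> z)\<bar> + 4 * c * \<epsilon> + h z * (g (\<xi> z) - f1 (\<xi> z))"
        using close[OF z, of "f\<epsilon> (\<xi> z)"] close[OF z, of "f1 (\<xi> z)"] by linarith
    qed (simp add: P1.integrable_loss gH f1H)
    also have "\<dots> = 2 * c * \<Delta> + 4 * c * \<epsilon> + (\<integral>z. h z * (g (\<xi> z) - f1 (\<xi> z)) \<partial>Q)"
      using int_u P1.integrable_mult_bounded[OF P1.diff_mem[OF gH f1H] h_meas h_le]
      by (simp add: \<Delta>_def P1.prob_space)
    also have "(\<integral>z. h z * (g (\<xi> z) - f1 (\<xi> z)) \<partial>Q) = - 2 * \<Lambda> * ip1 g (\<lambda>x. g x - f1 x)"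
      using foc_g[OF P1.diff_mem[OF gH f1H]] by simp
    finally have "P1.risk g - P1.risk f1 \<le> 2 * c * \<Delta> + 4 * c * \<epsilon> - 2 * \<Lambda> * ip1 g (\<lambda>x. g x - f1 x)"
      by simp
    moreover have "\<Lambda> * n\<^sup>2 \<le> P1.risk g - P1.risk f1 + \<Lambda> * ((ip_norm ip1 g)\<^sup>2 - (ip_norm ip1 f1)\<^sup>2)"
      using P1.svm_gap[OF f1 gH] by (simp add: n_def algebra_simps)
    \<comment> \<open>The linear term and the penalties together yield a second
      \<open>- (\<Lambda> * n\<^sup>2)\<close>. This doubles the left-hand side and halves the
      constants.\<close>
    moreover have "(ip_norm ip1 g)\<^sup>2 - (ip_norm ip1 f1)\<^sup>2 - 2 * ip1 g (\<lambda>x. g x - f1 x) = - n\<^sup>2"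
      unfolding n_def using gH f1H
      by (simp add: P1.ip_norm_square P1.diff_mem P1.ip_diff P1.ip_diff_right P1.ip_commute[OF f1H gH])
    then have "\<Lambda> * ((ip_norm ip1 g)\<^sup>2 - (ip_norm ip1 f1)\<^sup>2) - 2 * \<Lambda> * ip1 g (\<lambda>x. g x - f1 x) = - (\<Lambda> * n\<^sup>2)"
      by (metis mult.assoc mult.left_commute mult_minus_right right_diff_distrib)
    ultimately have "\<Lambda> * n\<^sup>2 \<le> c * \<Delta> + 2 * c * \<epsilon>" by linarith
    also have "\<dots> \<le> c * (c / (2 * \<Lambda>) * D) + 2 * c * \<epsilon>"
      using \<Delta>_le c by (intro add_right_mono mult_left_mono)
    finally have "n\<^sup>2 \<le> (c * (c / (2 * \<Lambda>) * D) + 2 * c * \<epsilon>) / \<Lambda>"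
      using \<Lambda> by (simp add: pos_le_divide_eq mult.commute)
    also have "\<dots> = c\<^sup>2 / (2 * \<Lambda>\<^sup>2) * D + 2 * c * \<epsilon> / \<Lambda>"
      using \<Lambda> by (simp add: power2_eq_square field_simps)
    finally show ?thesis by (rule real_le_rsqrt)
  qed
  \<comment> \<open>Smoothing changes the risk of every function in \<open>H2\<close> by at most
    \<open>2 * c * \<epsilon>\<close>; this is used at \<open>f\<epsilon>\<close> and at
    \<open>f2\<close>.\<close>
  have m_le: "m \<le> sqrt (4 * c * \<epsilon> / \<Lambda>)"
  proof -
    have risk_close: "\<bar>PE.risk f - P2.risk f\<bar> \<le> 2 * c * \<epsilon>" if f: "f \<in> H2" for f
    proof -
      let ?d = "\<lambda>z. smoothing \<epsilon> (l z) (f (\<xi> z)) - l z (f (\<xi> z))"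
      have int: "integrable Q ?d" by (simp add: PE.integrable_loss P2.integrable_loss f)
      have "\<bar>PE.risk f - P2.risk f\<bar> = \<bar>\<integral>z. ?d z \<partial>Q\<bar>"
        by (simp add: PE.risk_def P2.risk_def PE.integrable_loss P2.integrable_loss f)
      also have "\<dots> \<le> (\<integral>z. \<bar>?d z\<bar> \<partial>Q)"
        using integral_norm_bound[of Q ?d] by simp
      also have "\<dots> \<le> 2 * c * \<epsilon>"
        using close int by (intro P1.integral_le_const AE_I2) auto
      finally show ?thesis .
    qed
    have "PE.risk f\<epsilon> + \<Lambda> * (ip_norm ip2 f\<epsilon>)\<^sup>2 \<le> PE.risk f2 + \<Lambda> * (ip_norm ip2 f2)\<^sup>2"
      using f\<epsilon> f2H by (simp add: PE.is_svm_def)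
    then have "\<Lambda> * m\<^sup>2 \<le> 4 * c * \<epsilon>"
      using P2.svm_gap[OF f2 f\<epsilon>H] risk_close[OF f\<epsilon>H] risk_close[OF f2H] unfolding m_def by linarith
    then have "m\<^sup>2 \<le> 4 * c * \<epsilon> / \<Lambda>" using \<Lambda> by (simp add: pos_le_divide_eq mult.commute)
    then show ?thesis by (rule real_le_rsqrt)
  qed
  \<comment> \<open>The path from \<open>f1\<close> to \<open>f2\<close> runs through
    \<open>g\<close> and \<open>f\<epsilon>\<close>. The outer pieces stay within one RKHS each and
    are bounded uniformly; only the middle piece \<open>u\<close> crosses between the
    spaces.\<close>
  have "Lp_norm p \<mu> (\<lambda>x. f1 x - f2 x) \<le> \<bar>\<kappa> * n + \<kappa> * m\<bar> + Lp_norm p \<mu> u"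
  proof (rule \<mu>.Lp_norm_le_of_abs_le_const_add[OF p u_meas u_bound])
    show "\<bar>f1 x - f2 x\<bar> \<le> \<kappa> * n + \<kappa> * m + \<bar>u x\<bar>" for x
      using P1.abs_le_kappa_ip_norm[OF P1.diff_mem[OF gH f1H], of x]
        P2.abs_le_kappa_ip_norm[OF P2.diff_mem[OF f\<epsilon>H f2H], of x]
      by (simp add: n_def m_def u_def)
  qed
  also have "\<bar>\<kappa> * n + \<kappa> * m\<bar> = \<kappa> * n + \<kappa> * m" using n0 m0 \<kappa> by simp
  also have "\<dots> \<le> \<kappa> * sqrt (c\<^sup>2 / (2 * \<Lambda>\<^sup>2) * D + 2 * c * \<epsilon> / \<Lambda>) + \<kappa> * sqrt (4 * c * \<epsilon> / \<Lambda>)"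
    using n_le m_le \<kappa> by (intro add_mono mult_left_mono)
  finally show ?thesis using Lp_u by (simp add: \<mu>_def)
qed

text \<open>Neither the two SVMs nor \<open>D\<close> depend on the smoothing parameter, so the
  bound passes to the limit. There the root carries an extra factor \<open>1 / sqrt 2\<close>, which
  is weakened to 1.\<close>

lemma svm_diff_same_measure:
  assumes P1: "svm_problem S k1 H1 ip1 N \<kappa> Q l c \<xi> \<Lambda>" and P2: "svm_problem S k2 H2 ip2 N \<kappa> Q l c \<xi> \<Lambda>"
    and f1: "svm_problem.is_svm H1 ip1 Q l \<xi> \<Lambda> f1" and f2: "svm_problem.is_svm H2 ip2 Q l \<xi> \<Lambda> f2"
    and p: "1 \<le> p"
  defines "D \<equiv> Lp_norm p (distr Q N \<xi> \<Otimes>\<^sub>M distr Q N \<xi>) (\<lambda>(x, y). k1 x y - k2 x y)"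
  shows "Lp_norm p (distr Q N \<xi>) (\<lambda>x. f1 x - f2 x) \<le> c * (\<kappa> / \<Lambda> * sqrt D + 1 / (2 * \<Lambda>) * D)"
proof -
  interpret P1: svm_problem S k1 H1 ip1 N \<kappa> Q l c \<xi> \<Lambda> by fact
  note \<Lambda> = P1.lambda_pos and c = P1.lipschitz_nonneg and \<kappa> = P1.kappa_nonneg
  have D: "0 \<le> D" by (simp add: D_def Lp_norm_nonneg)
  let ?b = "\<lambda>\<epsilon>. \<kappa> * sqrt (c\<^sup>2 / (2 * \<Lambda>\<^sup>2) * D + 2 * c * \<epsilon> / \<Lambda>) + \<kappa> * sqrt (4 * c * \<epsilon> / \<Lambda>) + c / (2 * \<Lambda>) * D"
  have "(?b \<longlongrightarrow> ?b 0) (at_right 0)"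
    using \<Lambda> by (intro tendsto_intros) auto
  then have "Lp_norm p (distr Q N \<xi>) (\<lambda>x. f1 x - f2 x) \<le> ?b 0"
  proof (rule tendsto_lowerbound)
    show "\<forall>\<^sub>F \<epsilon> in at_right 0. Lp_norm p (distr Q N \<xi>) (\<lambda>x. f1 x - f2 x) \<le> ?b \<epsilon>"
      unfolding D_def
      by (rule eventually_mono[OF eventually_at_right_less[of 0]])
        (rule svm_diff_same_measure_approx[OF P1 P2 f1 f2 p])
  qed simp
  also have "?b 0 \<le> \<kappa> * (c / \<Lambda> * sqrt D) + c / (2 * \<Lambda>) * D"
  proof -
    have "c\<^sup>2 / (2 * \<Lambda>\<^sup>2) * D \<le> c\<^sup>2 / \<Lambda>\<^sup>2 * D"
      using \<Lambda> D by (intro mult_right_mono divide_left_mono) auto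
    then have "sqrt (c\<^sup>2 / (2 * \<Lambda>\<^sup>2) * D) \<le> sqrt (c\<^sup>2 / \<Lambda>\<^sup>2 * D)" by simp
    also have "\<dots> = c / \<Lambda> * sqrt D"
      using \<Lambda> c by (simp add: real_sqrt_mult real_sqrt_divide)
    finally have "\<kappa> * sqrt (c\<^sup>2 / (2 * \<Lambda>\<^sup>2) * D) \<le> \<kappa> * (c / \<Lambda> * sqrt D)"
      using \<kappa> by (rule mult_left_mono)
    then show ?thesis by simp
  qed
  also have "\<dots> = c * (\<kappa> / \<Lambda> * sqrt D + 1 / (2 * \<Lambda>) * D)"
    by (simp add: algebra_simps)
  finally show ?thesis .
qed


section \<open>Local measures and localized support vector machines\<close>

lemma tv_norm_commute:
  assumes "sets N = sets M"
  shows "tv_norm N (\<lambda>E. measure N E - measure M E) = tv_norm M (\<lambda>E. measure M E - measure N E)"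
  unfolding tv_norm_def assms sets_eq_imp_space_eq[OF assms] by (simp add: abs_minus_commute)

text \<open>The intermediate SVM uses \<open>Q1\<close> so that the kernel changes under the very
  measure in which \<open>D\<close> and the left-hand norm are taken. The remaining change from
  \<open>Q1\<close> to \<open>Q2\<close> is estimated uniformly and therefore fits any norm.\<close>

lemma svm_diff_le:
  assumes P1: "svm_problem S k1 H1 ip1 N \<kappa> Q1 l c \<xi> \<Lambda>\<^sub>1" and P2: "svm_problem S k2 H2 ip2 N \<kappa> Q2 l c \<xi> \<Lambda>\<^sub>2"
    and sets: "sets Q2 = sets Q1"
    and f1: "svm_problem.is_svm H1 ip1 Q1 l \<xi> \<Lambda>\<^sub>1 f1" and f2: "svm_problem.is_svm H2 ip2 Q2 l \<xi> \<Lambda>\<^sub>2 f2"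
    and \<tau>: "0 < \<tau>" "\<tau> \<le> \<Lambda>\<^sub>1" "\<tau> \<le> \<Lambda>\<^sub>2" and p: "1 \<le> p"
  defines "D \<equiv> Lp_norm p (distr Q1 N \<xi> \<Otimes>\<^sub>M distr Q1 N \<xi>) (\<lambda>(x, y). k1 x y - k2 x y)"
  shows "Lp_norm p (distr Q1 N \<xi>) (\<lambda>x. f1 x - f2 x) \<le>
    c * (\<kappa>\<^sup>2 / \<tau> * tv_norm Q1 (\<lambda>E. measure Q1 E - measure Q2 E) + \<kappa>\<^sup>2 / \<tau>\<^sup>2 * \<bar>\<Lambda>\<^sub>1 - \<Lambda>\<^sub>2\<bar>
      + 1 / (2 * \<tau>) * D + \<kappa> / \<tau> * sqrt D)"
proof -
  interpret P1: svm_problem S k1 H1 ip1 N \<kappa> Q1 l c \<xi> \<Lambda>\<^sub>1 by fact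
  interpret P2: svm_problem S k2 H2 ip2 N \<kappa> Q2 l c \<xi> \<Lambda>\<^sub>2 by fact
  interpret PM: svm_problem S k2 H2 ip2 N \<kappa> Q1 l c \<xi> \<Lambda>\<^sub>1
    by unfold_locales (rule P1.input_measurable P1.lambda_pos)+
  obtain f where f: "PM.is_svm f" using PM.ex_svm by blast
  interpret \<mu>: prob_space "distr Q1 N \<xi>"
    by (rule P1.prob_space_distr[OF P1.input_measurable])
  note f1H = P1.is_svm_mem[OF f1] and f2H = P2.is_svm_mem[OF f2] and fH = PM.is_svm_mem[OF f]
  note c = P1.lipschitz_nonneg and \<kappa> = P1.kappa_nonneg
  have D: "0 \<le> D" by (simp add: D_def Lp_norm_nonneg)
  let ?a = "c * (\<kappa>\<^sup>2 / \<tau> * tv_norm Q1 (\<lambda>E. measure Q1 E - measure Q2 E) + \<kappa>\<^sup>2 / \<tau>\<^sup>2 * \<bar>\<Lambda>\<^sub>1 - \<Lambda>\<^sub>2\<bar>)"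
  have diff: "\<bar>f x - f2 x\<bar> \<le> ?a" for x
    by (rule svm_diff_same_kernel[OF PM.svm_problem_axioms P2 sets f f2 \<tau>])
  have a: "0 \<le> ?a" using order_trans[OF abs_ge_zero diff] .
  have "Lp_norm p (distr Q1 N \<xi>) (\<lambda>x. f1 x - f2 x) \<le> \<bar>?a\<bar> + Lp_norm p (distr Q1 N \<xi>) (\<lambda>x. f1 x - f x)"
  proof (rule \<mu>.Lp_norm_le_of_abs_le_const_add[OF p])
    show "(\<lambda>x. f1 x - f x) \<in> borel_measurable (distr Q1 N \<xi>)"
      using P1.mem_measurable[OF f1H] P2.mem_measurable[OF fH] by simp
    show "\<bar>f1 x - f x\<bar> \<le> \<kappa> * ip_norm ip1 f1 + \<kappa> * ip_norm ip2 f" for x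
      using P1.abs_le_kappa_ip_norm[OF f1H, of x] P2.abs_le_kappa_ip_norm[OF fH, of x] by linarith
    show "\<bar>f1 x - f2 x\<bar> \<le> ?a + \<bar>f1 x - f x\<bar>" for x
      using diff[of x] by linarith
  qed
  also have "Lp_norm p (distr Q1 N \<xi>) (\<lambda>x. f1 x - f x) \<le> c * (\<kappa> / \<Lambda>\<^sub>1 * sqrt D + 1 / (2 * \<Lambda>\<^sub>1) * D)"
    unfolding D_def by (rule svm_diff_same_measure[OF P1 PM.svm_problem_axioms f1 f p])
  also have "\<dots> \<le> c * (\<kappa> / \<tau> * sqrt D + 1 / (2 * \<tau>) * D)"
    using \<tau> c \<kappa> D by (intro mult_left_mono add_mono mult_right_mono divide_left_mono) auto
  finally show ?thesis using a by (simp add: algebra_simps)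
qed

text \<open>\<open>arg_min_on\<close> is a choice; its value is a minimizer because
  \<open>ex_svm\<close> provides one.\<close>

lemma (in svm_problem) is_svm_arg_min_on:
  "is_svm (arg_min_on (\<lambda>f. risk f + \<Lambda> * (ip_norm ip f)\<^sup>2) H)"
proof -
  let ?J = "\<lambda>f. risk f + \<Lambda> * (ip_norm ip f)\<^sup>2"
  have "is_arg_min ?J (\<lambda>f. f \<in> H) f \<longleftrightarrow> is_svm f" for f
    by (auto simp: is_arg_min_def is_svm_def not_less)
  then show ?thesis
    using someI_ex[OF ex_svm] by (simp add: arg_min_on_def arg_min_def)
qed

lemma is_svm_svm:
  assumes "svm_problem S k H ip N \<kappa> Q (\<lambda>z. shifted_loss L (fst z) (snd z)) c fst \<Lambda>"
  shows "svm_problem.is_svm H ip Q (\<lambda>z. shifted_loss L (fst z) (snd z)) fst \<Lambda> (svm L Q \<Lambda> H ip)"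
proof -
  interpret svm_problem S k H ip N \<kappa> Q "\<lambda>z. shifted_loss L (fst z) (snd z)" c fst \<Lambda> by fact
  show ?thesis
    using is_svm_arg_min_on by (simp add: svm_def risk_def[abs_def] split_beta')
qed

text \<open>Each difference quotient is a lower bound of the set of Lipschitz constants, so the
  infimum is itself a Lipschitz constant.\<close>

lemma lipschitz_loss_abs_diff_le:
  assumes "lipschitz_loss Y L" "y \<in> Y"
  shows "\<bar>L x y s - L x y t\<bar> \<le> lipschitz_const Y L * \<bar>s - t\<bar>"
proof (cases "s = t")
  case False
  have "\<bar>L x y s - L x y t\<bar> / \<bar>s - t\<bar> \<le> Inf {c. lipschitz_loss_with c Y L}"
  proof (rule cInf_greatest)
    show "{c. lipschitz_loss_with c Y L} \<noteq> {}"
      using assms(1) by (auto simp: lipschitz_loss_def)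
    show "\<bar>L x y s - L x y t\<bar> / \<bar>s - t\<bar> \<le> c" if "c \<in> {c. lipschitz_loss_with c Y L}" for c
      using that assms(2) False lipschitz_onD[of c UNIV "L x y" s t]
      by (simp add: lipschitz_loss_with_def dist_real_def pos_divide_le_eq)
  qed
  then show ?thesis using False by (simp add: lipschitz_const_def pos_divide_le_eq)
qed simp

section \<open>Local measures, their marginals and zero-extensions\<close>

lemma marginal_UNIV: "marginal UNIV P = distr P borel fst"
  unfolding marginal_def by (rule distr_cong) (simp_all add: sets_restrict_UNIV)

lemma borel_measurable_zero_ext:
  assumes "A \<in> sets borel" "f \<in> borel_measurable (restrict_space borel A)"
  shows "zero_ext A f \<in> borel_measurable borel"
proof -
  have "zero_ext A f = (\<lambda>x. indicator A x *\<^sub>R f x)"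
    by (auto simp: zero_ext_def indicator_def)
  then show ?thesis
    using assms borel_measurable_restrict_space_iff[of A borel f] by simp
qed

locale labelled_prob_space = prob_space P
  for P :: "('x :: polish_space \<times> real) measure" +
  fixes Y :: "real set"
  assumes sets_P: "sets P = sets (restrict_space borel (UNIV \<times> Y))"
begin

lemma space_P: "space P = UNIV \<times> Y"
  using sets_eq_imp_space_eq[OF sets_P] by (simp add: space_restrict_space)

lemma cylinder_sets: "A \<in> sets borel \<Longrightarrow> A \<times> Y \<in> sets P"
  unfolding sets_P sets_restrict_space
  by (rule image_eqI[where x = "A \<times> UNIV"]) (auto simp: borel_prod[symmetric])

lemma sets_local_measure: "sets (local_measure Y P A) = sets (restrict_space (restrict_space borel (UNIV \<times> Y)) (A \<times> Y))"
  unfolding local_measure_def sets_scale_measure by (rule sets_restrict_space_cong[OF sets_P])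

lemma space_local_measure: "space (local_measure Y P A) = A \<times> Y"
  using space_P by (auto simp: local_measure_def space_scale_measure space_restrict_space)

lemma measurable_ident_local_measure: "(\<lambda>z. z) \<in> measurable (local_measure Y P A) borel"
proof -
  have "(\<lambda>z. z) \<in> measurable (restrict_space (restrict_space borel (UNIV \<times> Y)) (A \<times> Y)) borel"
    by (intro measurable_restrict_space1) simp
  then show ?thesis using measurable_cong_sets[OF sets_local_measure refl] by blast
qed

lemma measurable_fst_local_measure: "fst \<in> measurable (local_measure Y P A) (restrict_space borel A)"
proof (rule measurable_restrict_space2)
  show "fst \<in> measurable (local_measure Y P A) borel"
    using measurable_compose[OF measurable_ident_local_measure, of fst borel]
    by (simp add: borel_prod[symmetric])
qed (auto simp: space_local_measure)

lemma prob_space_local_measure: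
  assumes "A \<in> sets borel" "measure P (A \<times> Y) > 0"
  shows "prob_space (local_measure Y P A)"
proof
  have "emeasure P (A \<times> Y) \<noteq> 0" using assms(2) by (auto simp: measure_def)
  moreover have "emeasure (restrict_space P (A \<times> Y)) (A \<times> Y) = emeasure P (A \<times> Y)"
    using cylinder_sets[OF assms(1)] by (intro emeasure_restrict_space) simp_all
  ultimately show "emeasure (local_measure Y P A) (space (local_measure Y P A)) = 1"
    unfolding space_local_measure
    by (simp add: local_measure_def ennreal_divide_times emeasure_eq_measure ennreal_divide_self)
qed

lemma measurable_fst: "fst \<in> measurable P borel"
  using measurable_compose[of "\<lambda>z. z" P borel fst borel] measurable_cong_sets[OF sets_P refl]
  by (auto simp: borel_prod[symmetric] intro!: measurable_restrict_space1)

lemma measure_marginal: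
  assumes "A \<in> sets borel" shows "measure (marginal UNIV P) A = measure P (A \<times> Y)"
proof -
  have "fst -` A \<inter> space P = A \<times> Y" by (auto simp: space_P)
  then show ?thesis
    using assms measurable_fst by (simp add: marginal_UNIV measure_distr)
qed

text \<open>The computation uses nonnegative integrals, which follow scaling and restriction of a
  measure unconditionally. If they are infinite, \<open>enn2real\<close> makes both sides 0, in
  accordance with the Bochner integral.\<close>

lemma integral_zero_ext_marginal:
  assumes A: "A \<in> sets borel" "measure P (A \<times> Y) > 0"
    and f: "f \<in> borel_measurable (restrict_space borel A)" and f0: "\<And>x. 0 \<le> f x"
  shows "(\<integral>x. zero_ext A f x \<partial>marginal UNIV P) = measure P (A \<times> Y) * (\<integral>x. f x \<partial>marginal A (local_measure Y P A))"
proof -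
  note AY = cylinder_sets[OF A(1)]
  let ?e = "emeasure P (A \<times> Y)"
  note zf = borel_measurable_zero_ext[OF A(1) f]
  have "(\<integral>\<^sup>+x. f x \<partial>marginal A (local_measure Y P A)) = (\<integral>\<^sup>+z. f (fst z) \<partial>local_measure Y P A)"
    unfolding marginal_def using f by (intro nn_integral_distr[OF measurable_fst_local_measure]) simp
  also have "\<dots> = (1 / ?e) * (\<integral>\<^sup>+z. f (fst z) \<partial>restrict_space P (A \<times> Y))"
    unfolding local_measure_def
  proof (rule nn_integral_scale_measure)
    show "(\<lambda>z. ennreal (f (fst z))) \<in> borel_measurable (restrict_space P (A \<times> Y))"
      using measurable_compose[OF measurable_fst_local_measure f]
      by (simp add: local_measure_def cong: measurable_cong_sets)
  qed
  also have "(\<integral>\<^sup>+z. f (fst z) \<partial>restrict_space P (A \<times> Y)) = (\<integral>\<^sup>+z. ennreal (f (fst z)) * indicator (A \<times> Y) z \<partial>P)"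
    using AY by (intro nn_integral_restrict_space) simp
  also have "\<dots> = (\<integral>\<^sup>+z. zero_ext A f (fst z) \<partial>P)"
    by (intro nn_integral_cong) (auto simp: zero_ext_def indicator_def space_P)
  also have "\<dots> = (\<integral>\<^sup>+x. zero_ext A f x \<partial>marginal UNIV P)"
    unfolding marginal_UNIV using zf measurable_fst by (subst nn_integral_distr) auto
  finally have nn: "(\<integral>\<^sup>+x. f x \<partial>marginal A (local_measure Y P A)) = (1 / ?e) * (\<integral>\<^sup>+x. zero_ext A f x \<partial>marginal UNIV P)" .
  have "(\<integral>x. f x \<partial>marginal A (local_measure Y P A)) = enn2real (\<integral>\<^sup>+x. f x \<partial>marginal A (local_measure Y P A))"
    using f f0 by (intro integral_eq_nn_integral) (auto simp: marginal_def)
  moreover have "(\<integral>x. zero_ext A f x \<partial>marginal UNIV P) = enn2real (\<integral>\<^sup>+x. zero_ext A f x \<partial>marginal UNIV P)"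
    using zf f0 by (intro integral_eq_nn_integral) (auto simp: marginal_UNIV zero_ext_def)
  moreover have "enn2real (1 / ?e) = 1 / measure P (A \<times> Y)"
    using A(2) by (simp add: emeasure_eq_measure divide_ennreal flip: ennreal_1)
  ultimately show ?thesis using A(2) unfolding nn by (simp add: enn2real_mult)
qed

text \<open>The weight of a region in the theorem originates here: it is the \<open>p\<close>-th
  root of the normalizing constant of the local measure.\<close>

lemma Lp_norm_zero_ext:
  assumes A: "A \<in> sets borel" "measure P (A \<times> Y) > 0" and p: "1 \<le> p"
    and f: "f \<in> borel_measurable (restrict_space borel A)"
  shows "Lp_norm p (marginal UNIV P) (zero_ext A f) =
    measure (marginal UNIV P) A powr (1 / p) * Lp_norm p (marginal A (local_measure Y P A)) f"
proof -
  have "(\<integral>x. \<bar>zero_ext A f x\<bar> powr p \<partial>marginal UNIV P) = (\<integral>x. zero_ext A (\<lambda>x. \<bar>f x\<bar> powr p) x \<partial>marginal UNIV P)"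
    using p by (intro Bochner_Integration.integral_cong) (auto simp: zero_ext_def)
  also have "\<dots> = measure P (A \<times> Y) * (\<integral>x. \<bar>f x\<bar> powr p \<partial>marginal A (local_measure Y P A))"
    using f by (intro integral_zero_ext_marginal A) auto
  finally show ?thesis using A by (simp add: Lp_norm_def measure_marginal powr_mult)
qed

lemma local_svm_problem:
  assumes A: "A \<in> sets borel" "measure P (A \<times> Y) > 0"
    and k: "rkhs A k H ip" "measurable_kernel_on A k" "\<And>x. x \<in> A \<Longrightarrow> sqrt (k x x) \<le> \<kappa>"
    and L: "loss_function Y L" "convex_loss Y L" "lipschitz_loss Y L" and "\<Lambda> > 0"
  shows "svm_problem A k H ip (restrict_space borel A) \<kappa> (local_measure Y P A)
    (\<lambda>z. shifted_loss L (fst z) (snd z)) (lipschitz_const Y L) fst \<Lambda>"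
proof -
  interpret rkhs A k H ip by fact
  interpret Q: prob_space "local_measure Y P A" by (rule prob_space_local_measure[OF A])
  let ?Q = "local_measure Y P A"
  \<comment> \<open>A point of \<open>A\<close> is what forces the bound \<open>\<kappa>\<close> on
    the diagonal of the kernel to be nonnegative.\<close>
  have "A \<times> Y \<noteq> {}" using A(2) by auto
  then obtain x where x: "x \<in> A" by auto
  \<comment> \<open>\<open>L\<close> is measurable only on the restriction to labels in
    \<open>Y\<close>, so the rearrangement map has to land in that restricted space.\<close>
  have "(\<lambda>(z, t :: real). (fst z, snd z, t)) \<in> measurable (?Q \<Otimes>\<^sub>M borel) (restrict_space borel (UNIV \<times> Y \<times> UNIV))"
  proof (rule measurable_restrict_space2)
    have [measurable]: "fst \<in> measurable ?Q borel" "snd \<in> measurable ?Q borel"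
      using measurable_compose[OF measurable_ident_local_measure, of fst borel]
        measurable_compose[OF measurable_ident_local_measure, of snd borel]
      by (simp_all add: borel_prod[symmetric])
    have "(\<lambda>(z, t :: real). (fst z, snd z, t)) \<in> measurable (?Q \<Otimes>\<^sub>M borel) (borel \<Otimes>\<^sub>M borel \<Otimes>\<^sub>M borel)"
      by measurable
    then show "(\<lambda>(z, t :: real). (fst z, snd z, t)) \<in> measurable (?Q \<Otimes>\<^sub>M borel) borel"
      by (simp add: borel_prod)
  qed (auto simp: space_pair_measure space_local_measure)
  note compose = measurable_compose[OF this]
  have Lm: "(\<lambda>(z, t). L (fst z) (snd z) t) \<in> borel_measurable (?Q \<Otimes>\<^sub>M borel)"
    using compose[where g = "\<lambda>(x, y, t). L x y t" and L = borel] L(1)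
    by (simp add: loss_function_def case_prod_beta)
  have Lm0: "(\<lambda>(z, t :: real). L (fst z) (snd z) 0) \<in> borel_measurable (?Q \<Otimes>\<^sub>M borel)"
  proof -
    have "(\<lambda>w. (fst w, 0 :: real)) \<in> measurable (?Q \<Otimes>\<^sub>M (borel :: real measure)) (?Q \<Otimes>\<^sub>M borel)"
      by measurable
    from measurable_compose[OF this Lm] show ?thesis by (simp add: split_beta')
  qed
  show ?thesis
  proof
    show "space (restrict_space borel A) = A" by (simp add: space_restrict_space)
    show "case_prod k \<in> borel_measurable (restrict_space borel A \<Otimes>\<^sub>M restrict_space borel A)"
      using k(2) by (simp add: measurable_kernel_on_def)
    show "0 \<le> \<kappa>"
      using ip_norm_nonneg[OF section_mem[OF x]] k(3)[OF x] unfolding ip_norm_section[OF x]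
      by (rule order_trans)
    show "(\<lambda>(z, t). shifted_loss L (fst z) (snd z) t) \<in> borel_measurable (?Q \<Otimes>\<^sub>M borel)"
      using borel_measurable_diff[OF Lm Lm0] by (simp add: shifted_loss_def case_prod_beta)
    fix z assume "z \<in> space ?Q"
    then have z: "snd z \<in> Y" by (auto simp: space_local_measure)
    show "\<bar>shifted_loss L (fst z) (snd z) s - shifted_loss L (fst z) (snd z) t\<bar> \<le> lipschitz_const Y L * \<bar>s - t\<bar>" for s t
      using lipschitz_loss_abs_diff_le[OF L(3) z] by (simp add: shifted_loss_def)
    show "convex_on UNIV (shifted_loss L (fst z) (snd z))"
      using L(2) z unfolding convex_loss_def shifted_loss_def[abs_def] diff_conv_add_uminus
      by (intro convex_on_add) (auto simp: convex_on_const)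
  qed (use assms measurable_fst_local_measure in \<open>auto simp: shifted_loss_def\<close>)
qed

end

theorem theorem3p2:
  fixes Y :: "real set"
    and P :: "nat \<Rightarrow> ('x :: polish_space \<times> real) measure"
    and B :: nat
    and X :: "nat \<Rightarrow> 'x set"
    and \<Lambda> :: "nat \<Rightarrow> nat \<Rightarrow> real"
    and k :: "nat \<Rightarrow> nat \<Rightarrow> 'x \<Rightarrow> 'x \<Rightarrow> real"
    and H :: "nat \<Rightarrow> nat \<Rightarrow> ('x \<Rightarrow> real) set"
    and ip :: "nat \<Rightarrow> nat \<Rightarrow> ('x \<Rightarrow> real) \<Rightarrow> ('x \<Rightarrow> real) \<Rightarrow> real"
    and \<kappa> \<tau> :: "nat \<Rightarrow> real"
    and L :: "'x \<Rightarrow> real \<Rightarrow> real \<Rightarrow> real"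
    and w :: "nat \<Rightarrow> 'x \<Rightarrow> real"
    and p :: real and i :: nat
  assumes "closed Y"
    and "\<And>i. i \<in> {1, 2} \<Longrightarrow> prob_space (P i)"
    and "\<And>i. i \<in> {1, 2} \<Longrightarrow> sets (P i) = sets (restrict_space borel (UNIV \<times> Y))"
    and "\<And>b. b \<in> {1..B} \<Longrightarrow> X b \<in> sets borel"
    and "(\<Union>b\<in>{1..B}. X b) = UNIV"
    and "\<And>i b. i \<in> {1, 2} \<Longrightarrow> b \<in> {1..B} \<Longrightarrow> measure (P i) (X b \<times> Y) > 0"
    and "\<And>i b. i \<in> {1, 2} \<Longrightarrow> b \<in> {1..B} \<Longrightarrow> \<Lambda> i b > 0"
    and "\<And>i b. i \<in> {1, 2} \<Longrightarrow> b \<in> {1..B} \<Longrightarrow> kernel_on (X b) (k i b)"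
    and "\<And>i b. i \<in> {1, 2} \<Longrightarrow> b \<in> {1..B} \<Longrightarrow> bounded_kernel_on (X b) (k i b)"
    and "\<And>i b. i \<in> {1, 2} \<Longrightarrow> b \<in> {1..B} \<Longrightarrow> measurable_kernel_on (X b) (k i b)"
    and "\<And>i b. i \<in> {1, 2} \<Longrightarrow> b \<in> {1..B} \<Longrightarrow> rkhs (X b) (k i b) (H i b) (ip i b)"
    and "\<And>i b. i \<in> {1, 2} \<Longrightarrow> b \<in> {1..B} \<Longrightarrow> separable_rkhs (H i b) (ip i b)"
    and "\<And>b. b \<in> {1..B} \<Longrightarrow> \<kappa> b = max (kernel_norm (X b) (k 1 b)) (kernel_norm (X b) (k 2 b))"
    and "\<And>b. b \<in> {1..B} \<Longrightarrow> \<tau> b = min (\<Lambda> 1 b) (\<Lambda> 2 b)"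
    and "loss_function Y L" and "convex_loss Y L" and "lipschitz_loss Y L"
    and "\<And>b. b \<in> {1..B} \<Longrightarrow> w b \<in> borel_measurable borel"
    and "\<And>b x. b \<in> {1..B} \<Longrightarrow> w b x \<in> {0..1}"
    and "\<And>x. (\<Sum>b=1..B. w b x) = 1"
    and "\<And>b x. b \<in> {1..B} \<Longrightarrow> x \<notin> X b \<Longrightarrow> w b x = 0"
    and "p \<ge> 1" and "i \<in> {1, 2}"
  shows "Lp_norm p (marginal UNIV (P i))
           (\<lambda>x. localized_svm Y L B X w (P 1) (\<Lambda> 1) (H 1) (ip 1) x
              - localized_svm Y L B X w (P 2) (\<Lambda> 2) (H 2) (ip 2) x)
         \<le> lipschitz_const Y L *
           (\<Sum>b=1..B. measure (marginal UNIV (P i)) (X b) powr (1 / p) *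
             (let Q = (\<lambda>j. local_measure Y (P j) (X b));
                  D = Lp_norm p (marginal (X b) (Q i) \<Otimes>\<^sub>M marginal (X b) (Q i))
                        (\<lambda>(x, x'). k 1 b x x' - k 2 b x x')
              in (\<kappa> b)\<^sup>2 / \<tau> b * tv_norm (Q 1) (\<lambda>E. measure (Q 1) E - measure (Q 2) E)
               + (\<kappa> b)\<^sup>2 / (\<tau> b)\<^sup>2 * \<bar>\<Lambda> 1 b - \<Lambda> 2 b\<bar>
               + 1 / (2 * \<tau> b) * D
               + \<kappa> b / \<tau> b * sqrt D))"
    (is "_ \<le> ?c * (\<Sum>b=1..B. ?m b * ?E b)")
proof -
  have P: "labelled_prob_space (P j) Y" if "j \<in> {1, 2}" for j
    using assms(2,3)[OF that] by (simp add: labelled_prob_space_def labelled_prob_space_axioms_def)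
  interpret Pi: labelled_prob_space "P i" Y by (rule P[OF assms(23)])
  interpret M: prob_space "marginal UNIV (P i)"
    unfolding marginal_UNIV by (rule Pi.prob_space_distr[OF Pi.measurable_fst])
  let ?Q = "\<lambda>j b. local_measure Y (P j) (X b)"
  let ?l = "\<lambda>z. shifted_loss L (fst z) (snd z)"
  let ?f = "\<lambda>j b. svm L (?Q j b) (\<Lambda> j b) (H j b) (ip j b)"
  let ?d = "\<lambda>b x. ?f 1 b x - ?f 2 b x"
  have j: "1 \<in> {1, 2 :: nat}" "2 \<in> {1, 2 :: nat}" by auto
  have prob: "svm_problem (X b) (k j b) (H j b) (ip j b) (restrict_space borel (X b)) (\<kappa> b)
      (?Q j b) ?l ?c fst (\<Lambda> j b)" if j: "j \<in> {1, 2}" and b: "b \<in> {1..B}" for j b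
  proof (intro labelled_prob_space.local_svm_problem[OF P[OF j]])
    fix x assume "x \<in> X b"
    then have "sqrt (k j b x x) \<le> kernel_norm (X b) (k j b)"
      using assms(9)[OF j b] unfolding kernel_norm_def bounded_kernel_on_def by (rule cSUP_upper)
    then show "sqrt (k j b x x) \<le> \<kappa> b"
      using j assms(13)[OF b] by auto
  qed (use assms j b in auto)
  have svm: "svm_problem.is_svm (H j b) (ip j b) (?Q j b) ?l fst (\<Lambda> j b) (?f j b)"
    if "j \<in> {1, 2}" "b \<in> {1..B}" for j b
    by (rule is_svm_svm[OF prob[OF that]])
  have f: "?f j b \<in> H j b" if "j \<in> {1, 2}" "b \<in> {1..B}" for j b
    by (rule svm_problem.is_svm_mem[OF prob[OF that] svm[OF that]])
  have kernel: "bounded_kernel_rkhs (X b) (k j b) (H j b) (ip j b) (restrict_space borel (X b)) (\<kappa> b)"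
    if "j \<in> {1, 2}" "b \<in> {1..B}" for j b
    using prob[OF that] by (simp add: svm_problem_def)
  have f_meas: "?f j b \<in> borel_measurable (restrict_space borel (X b))" if "j \<in> {1, 2}" "b \<in> {1..B}" for j b
    by (rule bounded_kernel_rkhs.mem_measurable[OF kernel[OF that] f[OF that]])
  have d_meas: "?d b \<in> borel_measurable (restrict_space borel (X b))" if "b \<in> {1..B}" for b
    by (intro borel_measurable_diff f_meas j that)
  have zd_meas: "zero_ext (X b) (?d b) \<in> borel_measurable borel" if b: "b \<in> {1..B}" for b
    by (intro borel_measurable_zero_ext assms d_meas b)
  \<comment> \<open>These uniform bounds supply the boundedness that \<open>Lp_norm_sum_le\<close>
    and \<open>Lp_norm_mono\<close> ask for.\<close>
  define C where "C b = \<kappa> b * ip_norm (ip 1 b) (?f 1 b) + \<kappa> b * ip_norm (ip 2 b) (?f 2 b)" for b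
  have zd_le: "\<bar>zero_ext (X b) (?d b) x\<bar> \<le> C b" if b: "b \<in> {1..B}" for b x
  proof -
    have "\<bar>zero_ext (X b) (?d b) x\<bar> \<le> \<bar>?d b x\<bar>" by (simp add: zero_ext_def)
    then show ?thesis
      using bounded_kernel_rkhs.abs_le_kappa_ip_norm[OF kernel[OF j(1) b] f[OF j(1) b], of x]
        bounded_kernel_rkhs.abs_le_kappa_ip_norm[OF kernel[OF j(2) b] f[OF j(2) b], of x]
      unfolding C_def by linarith
  qed
  have wd_le: "\<bar>w b x * zero_ext (X b) (?d b) x\<bar> \<le> \<bar>zero_ext (X b) (?d b) x\<bar>" if "b \<in> {1..B}" for b x
    using assms(19)[OF that, of x] by (simp add: abs_mult mult_left_le_one_le)
  have local: "Lp_norm p (marginal (X b) (?Q i b)) (?d b) \<le> ?c * ?E b" if b: "b \<in> {1..B}" for b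
  proof -
    have sets: "sets (?Q 2 b) = sets (?Q 1 b)"
      unfolding labelled_prob_space.sets_local_measure[OF P[OF j(1)]]
        labelled_prob_space.sets_local_measure[OF P[OF j(2)]] ..
    have \<tau>: "0 < \<tau> b" "\<tau> b \<le> \<Lambda> 1 b" "\<tau> b \<le> \<Lambda> 2 b"
      using assms(7)[OF j(1) b] assms(7)[OF j(2) b] assms(14)[OF b] by auto
    note p1 = prob[OF j(1) b] and p2 = prob[OF j(2) b] and s1 = svm[OF j(1) b] and s2 = svm[OF j(2) b]
    \<comment> \<open>\<open>svm_diff_le\<close> takes its norms under the marginal of its first
      measure. For \<open>i = 2\<close> it is applied with the two problems exchanged; every term on
      the right is symmetric under this exchange.\<close>
    consider "i = 1" | "i = 2" using assms(23) by auto
    then show ?thesis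
    proof cases
      case 1
      then show ?thesis
        using svm_diff_le[OF p1 p2 sets s1 s2 \<tau> assms(22)] by (simp add: Let_def marginal_def)
    next
      case 2
      have "Lp_norm p M (\<lambda>x. ?f 2 b x - ?f 1 b x) = Lp_norm p M (?d b)" for M
        by (simp add: Lp_norm_def abs_minus_commute)
      moreover have "Lp_norm p M (\<lambda>(x, y). k 2 b x y - k 1 b x y) = Lp_norm p M (\<lambda>(x, y). k 1 b x y - k 2 b x y)" for M
        by (simp add: Lp_norm_def abs_minus_commute case_prod_beta)
      ultimately show ?thesis
        using 2 svm_diff_le[OF p2 p1 sets[symmetric] s2 s1 \<tau>(1,3,2) assms(22)] tv_norm_commute[OF sets]
        by (simp add: Let_def marginal_def abs_minus_commute[of "\<Lambda> 2 b"])
    qed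
  qed
  have "(\<lambda>x. localized_svm Y L B X w (P 1) (\<Lambda> 1) (H 1) (ip 1) x
      - localized_svm Y L B X w (P 2) (\<Lambda> 2) (H 2) (ip 2) x) = (\<lambda>x. \<Sum>b=1..B. w b x * zero_ext (X b) (?d b) x)"
    unfolding localized_svm_def sum_subtractf[symmetric]
    by (intro ext sum.cong) (auto simp: zero_ext_def right_diff_distrib)
  then have "Lp_norm p (marginal UNIV (P i))
           (\<lambda>x. localized_svm Y L B X w (P 1) (\<Lambda> 1) (H 1) (ip 1) x
              - localized_svm Y L B X w (P 2) (\<Lambda> 2) (H 2) (ip 2) x)
      = Lp_norm p (marginal UNIV (P i)) (\<lambda>x. \<Sum>b=1..B. w b x * zero_ext (X b) (?d b) x)"
    by simp
  also have "\<dots> \<le> (\<Sum>b=1..B. Lp_norm p (marginal UNIV (P i)) (\<lambda>x. w b x * zero_ext (X b) (?d b) x))"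
  proof (rule M.Lp_norm_sum_le[OF assms(22)])
    show "(\<lambda>x. w b x * zero_ext (X b) (?d b) x) \<in> borel_measurable (marginal UNIV (P i))" if "b \<in> {1..B}" for b
      using zd_meas[OF that] assms(18)[OF that] by (simp add: marginal_UNIV)
    show "\<bar>w b x * zero_ext (X b) (?d b) x\<bar> \<le> C b" if "b \<in> {1..B}" for b x
      using wd_le[OF that] zd_le[OF that] by (rule order_trans)
  qed simp
  also have "\<dots> \<le> (\<Sum>b=1..B. Lp_norm p (marginal UNIV (P i)) (zero_ext (X b) (?d b)))"
  proof (intro sum_mono M.Lp_norm_mono)
    show "zero_ext (X b) (?d b) \<in> borel_measurable (marginal UNIV (P i))" if "b \<in> {1..B}" for b
      using zd_meas[OF that] by (simp add: marginal_UNIV)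
  qed (use assms(22) zd_le wd_le in auto)
  also have "\<dots> = (\<Sum>b=1..B. ?m b * Lp_norm p (marginal (X b) (?Q i b)) (?d b))"
    by (intro sum.cong refl Pi.Lp_norm_zero_ext assms d_meas)
  also have "\<dots> \<le> (\<Sum>b=1..B. ?m b * (?c * ?E b))"
    by (intro sum_mono mult_left_mono local) auto
  also have "\<dots> = ?c * (\<Sum>b=1..B. ?m b * ?E b)"
    by (simp only: sum_distrib_left mult.left_commute)
  finally show ?thesis .
qed

end
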